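(* Let $F_2$ be the free group of rank $2$. The real vector space of homogeneous quasimorphisms $q\colon F_2\to\mathbb R$ that are $\mathrm{Aut}(F_2)$-invariant, i.e. satisfy $q(\psi(x))=q(x)$ for all $x\in F_2$ and all $\psi\in\mathrm{Aut}(F_2)$, is infinite dimensional.
   Context: A quasimorphism on a group $G$ is a function $q\colon G\to\mathbb R$ for which there is $D$ with $|q(a)-q(ab)+q(b)|<D$ for all $a,b\in G$; it is homogeneous if $q(x^n)=nq(x)$ for all $n\in\mathbb Z$, $x\in G$. *)

theory Defs
  imports Complex_Main "HOL-Algebra.Group" "HOL-Library.Function_Algebras"
begin

section \<open>Free groups\<close>

text \<open>
  A letter \<open>(s, True)\<close> stands for the generator \<open>s\<close> and \<open>(s, False)\<close> for its inverse. The
  elements of the free group on \<open>S\<close> are the freely reduced words over \<open>S\<close>; the product is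
  concatenation followed by free reduction.
\<close>

type_synonym 'a letter = "'a \<times> bool"

definition inv_letter :: "'a letter \<Rightarrow> 'a letter" where
  "inv_letter x = (fst x, \<not> snd x)"

definition reduced :: "'a letter list \<Rightarrow> bool" where
  "reduced = successively (\<lambda>x y. y \<noteq> inv_letter x)"

fun cons_cancel :: "'a letter \<Rightarrow> 'a letter list \<Rightarrow> 'a letter list" where
  "cons_cancel x [] = [x]"
| "cons_cancel x (y # w) = (if y = inv_letter x then w else x # y # w)"

definition reduce :: "'a letter list \<Rightarrow> 'a letter list" where
  "reduce w = foldr cons_cancel w []"

definition free_group :: "'a set \<Rightarrow> 'a letter list monoid" where
  "free_group S =
     \<lparr>carrier = {w. reduced w \<and> fst ` set w \<subseteq> S}, mult = (\<lambda>u v. reduce (u @ v)), one = []\<rparr>"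

lemma inv_letter_simps [simp]:
  "inv_letter (inv_letter x) = x" "inv_letter x \<noteq> x" "x \<noteq> inv_letter x"
  "fst (inv_letter x) = fst x"
  by (cases x; simp add: inv_letter_def)+

lemma reduced_Nil [simp]: "reduced []"
  and reduced_Cons: "reduced (x # w) \<longleftrightarrow> reduced w \<and> (w = [] \<or> hd w \<noteq> inv_letter x)"
  by (auto simp: reduced_def successively_Cons)

lemma cons_cancel_reduced: "reduced (x # w) \<Longrightarrow> cons_cancel x w = x # w"
  by (cases w) (auto simp: reduced_Cons)

lemma reduced_cons_cancel: "reduced w \<Longrightarrow> reduced (cons_cancel x w)"
  by (cases w) (auto simp: reduced_Cons)

lemma set_cons_cancel: "set (cons_cancel x w) \<subseteq> insert x (set w)"
  by (cases w) auto

lemma cons_cancel_inverse: "reduced w \<Longrightarrow> cons_cancel x (cons_cancel (inv_letter x) w) = w"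
proof (cases w)
  case (Cons y v)
  assume "reduced w"
  then show ?thesis using Cons by (cases v) (auto simp: reduced_Cons)
qed simp

lemma reduced_foldr: "reduced v \<Longrightarrow> reduced (foldr cons_cancel u v)"
  by (induction u) (auto intro: reduced_cons_cancel)

lemma reduced_reduce: "reduced (reduce w)"
  by (simp add: reduce_def reduced_foldr)

lemma reduce_reduced: "reduced w \<Longrightarrow> reduce w = w"
  by (induction w) (auto simp: reduce_def reduced_Cons cons_cancel_reduced)

lemma reduce_append: "reduce (u @ v) = foldr cons_cancel u (reduce v)"
  by (simp add: reduce_def)

lemma set_reduce: "set (reduce w) \<subseteq> set w"
  unfolding reduce_def
proof (induction w)
  case (Cons x w)
  then show ?case using set_cons_cancel[of x "foldr cons_cancel w []"] by auto
qed simp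

lemma foldr_cons_cancel:
  assumes "reduced v"
  shows "foldr cons_cancel (cons_cancel x w) v = cons_cancel x (foldr cons_cancel w v)"
proof (cases w)
  case (Cons y u)
  show ?thesis
  proof (cases "y = inv_letter x")
    case True
    then show ?thesis
      using Cons cons_cancel_inverse[OF reduced_foldr[OF assms], of x u] by simp
  qed (use Cons in simp)
qed simp

lemma foldr_reduce:
  assumes "reduced v"
  shows "foldr cons_cancel (reduce u) v = foldr cons_cancel u v"
  by (induction u) (auto simp: reduce_def foldr_cons_cancel[OF assms])

lemma reduce_reduce_left: "reduce (reduce u @ v) = reduce (u @ v)"
  by (simp add: reduce_append foldr_reduce reduced_reduce)

lemma reduce_reduce_right: "reduce (u @ reduce v) = reduce (u @ v)"
  by (simp add: reduce_append reduce_reduced reduced_reduce)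

lemma foldr_inverse:
  "reduced v \<Longrightarrow> foldr cons_cancel (rev (map inv_letter u)) (foldr cons_cancel u v) = v"
proof (induction u)
  case (Cons x u)
  then show ?case
    using cons_cancel_inverse[OF reduced_foldr[OF Cons.prems], of "inv_letter x" u] by simp
qed simp

lemma group_free_group: "group (free_group S)"
proof (rule groupI)
  fix u v w
  assume u: "u \<in> carrier (free_group S)" and v: "v \<in> carrier (free_group S)"
  show "u \<otimes>\<^bsub>free_group S\<^esub> v \<in> carrier (free_group S)"
    using u v set_reduce[of "u @ v"] by (fastforce simp: free_group_def reduced_reduce)
  show "u \<otimes>\<^bsub>free_group S\<^esub> v \<otimes>\<^bsub>free_group S\<^esub> w = u \<otimes>\<^bsub>free_group S\<^esub> (v \<otimes>\<^bsub>free_group S\<^esub> w)"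
    by (simp add: free_group_def reduce_reduce_left reduce_reduce_right)
  show "\<one>\<^bsub>free_group S\<^esub> \<otimes>\<^bsub>free_group S\<^esub> u = u"
    using u by (simp add: free_group_def reduce_reduced)
  have "reduce (reduce (rev (map inv_letter u)) @ u) = []"
    using foldr_inverse[of "[]" u]
    by (simp add: reduce_reduce_left) (simp add: reduce_def)
  moreover have "fst ` set (reduce (rev (map inv_letter u))) \<subseteq> S"
  proof -
    have "fst ` set (rev (map inv_letter u)) \<subseteq> S"
      using u by (auto simp: free_group_def)
    then show ?thesis using set_reduce[of "rev (map inv_letter u)"] by blast
  qed
  ultimately show "\<exists>y\<in>carrier (free_group S). y \<otimes>\<^bsub>free_group S\<^esub> u = \<one>\<^bsub>free_group S\<^esub>"
    by (intro bexI[of _ "reduce (rev (map inv_letter u))"])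
       (auto simp: free_group_def reduced_reduce)
qed (simp add: free_group_def)

text \<open>The universal property of \<open>free_group S\<close>:\<close>

definition letter_value :: "('b, 'c) monoid_scheme \<Rightarrow> ('a \<Rightarrow> 'b) \<Rightarrow> 'a letter \<Rightarrow> 'b" where
  "letter_value H f x = (if snd x then f (fst x) else inv\<^bsub>H\<^esub> f (fst x))"

definition word_value :: "('b, 'c) monoid_scheme \<Rightarrow> ('a \<Rightarrow> 'b) \<Rightarrow> 'a letter list \<Rightarrow> 'b" where
  "word_value H f w = foldr (\<lambda>x y. letter_value H f x \<otimes>\<^bsub>H\<^esub> y) w \<one>\<^bsub>H\<^esub>"

lemma word_value_simps [simp]:
  "word_value H f [] = \<one>\<^bsub>H\<^esub>"
  "word_value H f (x # w) = letter_value H f x \<otimes>\<^bsub>H\<^esub> word_value H f w"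
  by (simp_all add: word_value_def)

theorem free_group_universal:
  assumes "group H" and f: "f \<in> S \<rightarrow> carrier H"
  shows "\<exists>h \<in> hom (free_group S) H. (\<forall>s\<in>S. h [(s, True)] = f s) \<and>
           (\<forall>h' \<in> hom (free_group S) H. (\<forall>s\<in>S. h' [(s, True)] = f s) \<longrightarrow>
              (\<forall>x \<in> carrier (free_group S). h' x = h x))"
proof -
  interpret H: group H by fact
  interpret F: group "free_group S" by (rule group_free_group)
  let ?l = "letter_value H f" and ?h = "word_value H f"
  have l: "?l x \<in> carrier H" if "fst x \<in> S" for x
    using that f by (auto simp: letter_value_def)
  have li: "?l x \<otimes>\<^bsub>H\<^esub> ?l (inv_letter x) = \<one>\<^bsub>H\<^esub>" if "fst x \<in> S" for x
    using that f by (auto simp: letter_value_def inv_letter_def Pi_iff)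
  have h: "?h w \<in> carrier H" if "fst ` set w \<subseteq> S" for w
    using that by (induction w) (auto intro: l)
  have hc: "?h (cons_cancel x w) = ?l x \<otimes>\<^bsub>H\<^esub> ?h w" if "fst x \<in> S" "fst ` set w \<subseteq> S" for x w
  proof (cases w)
    case (Cons y u)
    show ?thesis
    proof (cases "y = inv_letter x")
      case True
      have "?l x \<otimes>\<^bsub>H\<^esub> (?l y \<otimes>\<^bsub>H\<^esub> ?h u) = ?l x \<otimes>\<^bsub>H\<^esub> ?l y \<otimes>\<^bsub>H\<^esub> ?h u"
        using that Cons by (intro H.m_assoc[symmetric] l h) auto
      also have "\<dots> = ?h u"
        using True li[of x] that Cons h[of u] by simp
      finally show ?thesis using True Cons by simp
    qed (use Cons in simp)
  qed simp
  have hf: "?h (foldr cons_cancel u v) = ?h u \<otimes>\<^bsub>H\<^esub> ?h v \<and> fst ` set (foldr cons_cancel u v) \<subseteq> S"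
    if "fst ` set u \<subseteq> S" "fst ` set v \<subseteq> S" for u v
    using that
  proof (induction u)
    case Nil
    then show ?case using h by simp
  next
    case (Cons x u)
    have "?l x \<otimes>\<^bsub>H\<^esub> (?h u \<otimes>\<^bsub>H\<^esub> ?h v) = ?l x \<otimes>\<^bsub>H\<^esub> ?h u \<otimes>\<^bsub>H\<^esub> ?h v"
      using Cons.prems by (intro H.m_assoc[symmetric] l h) auto
    moreover have "fst ` set (cons_cancel x w) \<subseteq> S" if "fst ` set w \<subseteq> S" for w
    proof -
      have "fst ` set (cons_cancel x w) \<subseteq> fst ` insert x (set w)"
        by (intro image_mono set_cons_cancel)
      also have "\<dots> \<subseteq> S" using that Cons.prems by simp
      finally show ?thesis .
    qed
    ultimately show ?case
      using Cons hc[of x "foldr cons_cancel u v"] by simp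
  qed
  have hom: "?h \<in> hom (free_group S) H"
  proof (rule homI)
    fix u v
    assume u: "u \<in> carrier (free_group S)" and v: "v \<in> carrier (free_group S)"
    show "?h u \<in> carrier H" using u h by (simp add: free_group_def)
    show "?h (u \<otimes>\<^bsub>free_group S\<^esub> v) = ?h u \<otimes>\<^bsub>H\<^esub> ?h v"
      using u v hf[of u v] by (simp add: free_group_def reduce_append reduce_reduced)
  qed
  have gen: "\<forall>s\<in>S. ?h [(s, True)] = f s"
    using f by (auto simp: letter_value_def Pi_iff)
  have uniq: "h' x = ?h x"
    if h': "h' \<in> hom (free_group S) H" and g: "\<forall>s\<in>S. h' [(s, True)] = f s"
      and x: "x \<in> carrier (free_group S)" for h' x
  proof -
    interpret h': group_hom "free_group S" H h' by unfold_locales (rule h')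
    have lt: "h' [a] = ?l a" if "fst a \<in> S" for a
    proof (cases "snd a")
      case True
      then have "a = (fst a, True)" by (cases a) auto
      with g that True show ?thesis by (metis letter_value_def)
    next
      case False
      then have a: "[a] \<otimes>\<^bsub>free_group S\<^esub> [(fst a, True)] = \<one>\<^bsub>free_group S\<^esub>"
        by (cases a) (auto simp: free_group_def reduce_def inv_letter_def)
      have c: "[(fst a, True)] \<in> carrier (free_group S)" "[a] \<in> carrier (free_group S)"
        using that by (simp_all add: free_group_def reduced_Cons)
      have "[a] = inv\<^bsub>free_group S\<^esub> [(fst a, True)]"
        using F.inv_equality[OF a c] by simp
      then have "h' [a] = inv\<^bsub>H\<^esub> h' [(fst a, True)]"
        using h'.hom_inv[OF c(1)] by simp
      then show ?thesis using False that g by (simp add: letter_value_def)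
    qed
    show ?thesis using x
    proof (induction x)
      case Nil
      then show ?case using h'.hom_one by (simp add: free_group_def)
    next
      case (Cons a w)
      then have w: "w \<in> carrier (free_group S)" and a: "fst a \<in> S"
        and a': "[a] \<in> carrier (free_group S)"
        by (auto simp: free_group_def reduced_Cons)
      have "[a] \<otimes>\<^bsub>free_group S\<^esub> w = a # w"
        using Cons.prems by (simp add: free_group_def reduce_reduced)
      then have "h' (a # w) = h' [a] \<otimes>\<^bsub>H\<^esub> h' w"
        using h'.hom_mult[OF a' w] by simp
      then show ?case using Cons.IH[OF w] lt[OF a] by simp
    qed
  qed
  show ?thesis
    by (rule bexI[OF _ hom]) (use gen uniq in blast)
qed

definition F2 :: "bool letter list monoid" where
  "F2 = free_group (UNIV :: bool set)"


section \<open>Real-valued functions as a vector space\<close>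

instantiation "fun" :: (type, real_vector) real_vector
begin

definition scaleR_fun :: "real \<Rightarrow> ('a \<Rightarrow> 'b) \<Rightarrow> 'a \<Rightarrow> 'b" where
  "scaleR_fun c f = (\<lambda>x. c *\<^sub>R f x)"

instance
  by standard (auto simp: scaleR_fun_def fun_eq_iff scaleR_add_right scaleR_add_left)

end

text \<open>To be applied to linear subspaces only: no finite subset of \<open>V\<close> is a basis of \<open>V\<close>.\<close>

definition infinite_dimensional :: "'a::real_vector set \<Rightarrow> bool" where
  "infinite_dimensional V \<longleftrightarrow> \<not> (\<exists>B. finite B \<and> independent B \<and> span B = V)"


section \<open>Quasimorphisms\<close>

definition quasimorphism :: "('a, 'b) monoid_scheme \<Rightarrow> ('a \<Rightarrow> real) \<Rightarrow> bool" where
  "quasimorphism G q \<longleftrightarrow>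
     (\<exists>D. \<forall>a\<in>carrier G. \<forall>b\<in>carrier G. \<bar>q a - q (a \<otimes>\<^bsub>G\<^esub> b) + q b\<bar> < D)"

definition homogeneous :: "('a, 'b) monoid_scheme \<Rightarrow> ('a \<Rightarrow> real) \<Rightarrow> bool" where
  "homogeneous G q \<longleftrightarrow> (\<forall>x\<in>carrier G. \<forall>n::int. q (x [^]\<^bsub>G\<^esub> n) = of_int n * q x)"

definition Aut_invariant :: "('a, 'b) monoid_scheme \<Rightarrow> ('a \<Rightarrow> real) \<Rightarrow> bool" where
  "Aut_invariant G q \<longleftrightarrow> (\<forall>\<psi>\<in>iso G G. \<forall>x\<in>carrier G. q (\<psi> x) = q x)"

text \<open>
  A function on \<open>G\<close> is represented by its extension by zero outside the carrier, so that equality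
  and linear combinations are those of functions on \<open>G\<close>.
\<close>

definition invariant_quasimorphisms :: "('a, 'b) monoid_scheme \<Rightarrow> ('a \<Rightarrow> real) set" where
  "invariant_quasimorphisms G =
     {q. quasimorphism G q \<and> homogeneous G q \<and> Aut_invariant G q \<and>
         (\<forall>x. x \<notin> carrier G \<longrightarrow> q x = 0)}"

lemma subspace_invariant_quasimorphisms: "subspace (invariant_quasimorphisms G)"
proof (rule subspaceI)
  show "0 \<in> invariant_quasimorphisms G"
    by (auto simp: invariant_quasimorphisms_def quasimorphism_def homogeneous_def
        Aut_invariant_def intro: exI[of _ 1])
next
  fix p q
  assume p: "p \<in> invariant_quasimorphisms G" and q: "q \<in> invariant_quasimorphisms G"
  obtain D E where
    D: "\<And>a b. a \<in> carrier G \<Longrightarrow> b \<in> carrier G \<Longrightarrow> \<bar>p a - p (a \<otimes>\<^bsub>G\<^esub> b) + p b\<bar> < D" and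
    E: "\<And>a b. a \<in> carrier G \<Longrightarrow> b \<in> carrier G \<Longrightarrow> \<bar>q a - q (a \<otimes>\<^bsub>G\<^esub> b) + q b\<bar> < E"
    using p q unfolding invariant_quasimorphisms_def quasimorphism_def by blast
  have "quasimorphism G (p + q)"
    unfolding quasimorphism_def
  proof (intro exI ballI)
    fix a b assume "a \<in> carrier G" "b \<in> carrier G"
    then show "\<bar>(p + q) a - (p + q) (a \<otimes>\<^bsub>G\<^esub> b) + (p + q) b\<bar> < D + E"
      using D[of a b] E[of a b] by simp
  qed
  then show "p + q \<in> invariant_quasimorphisms G"
    using p q by (auto simp: invariant_quasimorphisms_def homogeneous_def Aut_invariant_def
        algebra_simps)
next
  fix c :: real and q
  assume q: "q \<in> invariant_quasimorphisms G"
  obtain D where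
    D: "\<And>a b. a \<in> carrier G \<Longrightarrow> b \<in> carrier G \<Longrightarrow> \<bar>q a - q (a \<otimes>\<^bsub>G\<^esub> b) + q b\<bar> < D"
    using q unfolding invariant_quasimorphisms_def quasimorphism_def by blast
  have "quasimorphism G (c *\<^sub>R q)"
    unfolding quasimorphism_def
  proof (intro exI ballI)
    fix a b assume "a \<in> carrier G" "b \<in> carrier G"
    then have "\<bar>c\<bar> * \<bar>q a - q (a \<otimes>\<^bsub>G\<^esub> b) + q b\<bar> \<le> \<bar>c\<bar> * D"
      using D[of a b] by (intro mult_left_mono) auto
    also have "\<bar>c\<bar> * \<bar>q a - q (a \<otimes>\<^bsub>G\<^esub> b) + q b\<bar>
        = \<bar>(c *\<^sub>R q) a - (c *\<^sub>R q) (a \<otimes>\<^bsub>G\<^esub> b) + (c *\<^sub>R q) b\<bar>"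
      by (simp add: scaleR_fun_def abs_mult[symmetric] algebra_simps)
    finally show "\<bar>(c *\<^sub>R q) a - (c *\<^sub>R q) (a \<otimes>\<^bsub>G\<^esub> b) + (c *\<^sub>R q) b\<bar> < \<bar>c\<bar> * D + 1"
      by simp
  qed
  then show "c *\<^sub>R q \<in> invariant_quasimorphisms G"
    using q by (auto simp: invariant_quasimorphisms_def homogeneous_def Aut_invariant_def
        scaleR_fun_def)
qed

end

theory Submission
  imports Defs
begin

text \<open>
  Let \<open>K \<le> F\<^sub>2\<close> be the kernel of \<open>F\<^sub>2 \<rightarrow> (\<int>/2)\<^sup>2\<close>, the fundamental group of a torus with four
  punctures. The hyperelliptic involution embeds \<open>K\<close> into the fundamental group of a sphere with four
  punctures, and filling in one of the four punctures maps \<open>K\<close> to the fundamental group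
  \<open>Q \<cong> F\<^sub>2\<close> of a sphere with three punctures. Automorphisms of \<open>F\<^sub>2\<close> permute these four maps up to
  automorphisms of \<open>Q\<close> that preserve the peripheral structure, and the latter form a finite group
  modulo inner automorphisms. Hence a quasimorphism on \<open>Q\<close>, symmetrised over that finite group and
  summed over the four maps, extends to a homogeneous quasimorphism on \<open>F\<^sub>2\<close> that is invariant under
  all automorphisms. By Nielsen's theorem it is enough to check this for the Nielsen moves.

  On \<open>Q\<close> we take quasimorphisms that compare how often a run of length 2 is followed by one of
  length \<open>n\<close> with how often it is preceded by one. They are invariant under signed permutations of
  the generators, so only a symmetrisation of order three remains, whose two nontrivial terms
  vanish on the words that detect the independence of the resulting family.
\<close>

section \<open>Free groups as additively written groups\<close>

text \<open>A type of its own lets the free group be an instance of \<open>group_add\<close>; its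
  noncommutative product is written \<open>+\<close>.\<close>

typedef 'a fgroup = "{w :: 'a letter list. reduced w}"
  morphisms word Abs_fgroup
  by (rule exI[of _ "[]"]) simp

definition of_word :: "'a letter list \<Rightarrow> 'a fgroup" where
  "of_word w = Abs_fgroup (reduce w)"

lemma reduced_word [simp]: "reduced (word x)"
  using word by blast

lemma word_of_word: "word (of_word w) = reduce w"
  by (simp add: of_word_def Abs_fgroup_inverse reduced_reduce)

lemma word_of_reduced: "reduced w \<Longrightarrow> word (of_word w) = w"
  by (simp add: word_of_word reduce_reduced)

lemma of_word_word [simp]: "of_word (word x) = x"
  by (metis reduced_word word_inject word_of_reduced)

lemma of_word_eqI: "reduce u = reduce v \<Longrightarrow> of_word u = of_word v"
  by (simp add: of_word_def)

abbreviation inv_word :: "'a letter list \<Rightarrow> 'a letter list" where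
  "inv_word w \<equiv> rev (map inv_letter w)"

lemma reduce_inv_word: "reduce (inv_word u @ u) = []" "reduce (u @ inv_word u) = []"
proof -
  have *: "reduce (inv_word u @ u) = []" for u :: "'a letter list"
    using foldr_inverse[of "[]" u] by (simp add: reduce_def)
  show "reduce (inv_word u @ u) = []" by (rule *)
  show "reduce (u @ inv_word u) = []"
    using *[of "inv_word u"] by (simp add: rev_map[symmetric] comp_def)
qed

instantiation fgroup :: (type) group_add
begin

definition zero_fgroup :: "'a fgroup" where "0 = of_word []"
definition plus_fgroup :: "'a fgroup \<Rightarrow> 'a fgroup \<Rightarrow> 'a fgroup" where
  "x + y = of_word (word x @ word y)"
definition uminus_fgroup :: "'a fgroup \<Rightarrow> 'a fgroup" where
  "- x = of_word (inv_word (word x))"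
definition minus_fgroup :: "'a fgroup \<Rightarrow> 'a fgroup \<Rightarrow> 'a fgroup" where
  "x - y = x + - (y :: 'a fgroup)"

instance
proof
  fix x y z :: "'a fgroup"
  show "x + y + z = x + (y + z)"
    by (simp add: plus_fgroup_def word_of_word)
       (intro of_word_eqI, simp add: reduce_reduce_left reduce_reduce_right)
  show "0 + x = x" "x + 0 = x"
    by (simp_all add: plus_fgroup_def zero_fgroup_def word_of_word reduce_def)
  show "- x + x = 0"
    unfolding plus_fgroup_def zero_fgroup_def uminus_fgroup_def word_of_word
    by (intro of_word_eqI)
      (simp add: reduce_reduce_left reduce_inv_word, simp add: reduce_def)
qed (simp add: minus_fgroup_def)

end

lemma of_word_append: "of_word (u @ v) = of_word u + of_word v"
  by (simp add: plus_fgroup_def word_of_word)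
    (intro of_word_eqI, simp add: reduce_reduce_left reduce_reduce_right)

lemma word_0 [simp]: "word 0 = []"
  by (simp add: zero_fgroup_def word_of_word reduce_def)

lemma of_word_Nil [simp]: "of_word [] = 0"
  by (simp add: zero_fgroup_def)

lemma of_word_Cons: "of_word (l # w) = of_word [l] + of_word w"
  using of_word_append[of "[l]" w] by simp

lemma of_word_inv_word: "of_word (inv_word w) = - of_word w"
proof -
  have "of_word (inv_word w) + of_word w = of_word []"
    unfolding of_word_append[symmetric]
    by (rule of_word_eqI) (simp add: reduce_inv_word, simp add: reduce_def)
  then show ?thesis by (simp add: eq_neg_iff_add_eq_0)
qed

lemma of_word_inv_letter: "of_word [inv_letter l] = - of_word [l]"
  using of_word_inv_word[of "[l]"] by simp

lemma reduced_append:
  "reduced (u @ v) \<longleftrightarrow> reduced u \<and> reduced v \<and> (u = [] \<or> v = [] \<or> hd v \<noteq> inv_letter (last u))"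
  by (auto simp: reduced_def successively_append_iff)

lemma inv_letter_eq_iff: "inv_letter x = y \<longleftrightarrow> x = inv_letter y"
  by auto

lemma reduced_inv_word: "reduced w \<Longrightarrow> reduced (inv_word w)"
  by (induction w) (auto simp: reduced_append reduced_Cons last_rev hd_map)

lemma word_uminus: "word (- x) = inv_word (word x)"
  by (simp add: uminus_fgroup_def word_of_reduced reduced_inv_word)

definition gen :: "'a \<Rightarrow> 'a fgroup" where
  "gen s = of_word [(s, True)]"

lemma of_word_single: "of_word [l] = (if snd l then gen (fst l) else - gen (fst l))"
  using of_word_inv_letter[of "(fst l, True)"]
  by (cases l) (auto simp: gen_def inv_letter_def)

lemma fgroup_induct [case_names zero add]:
  assumes "P 0" "\<And>l x. P x \<Longrightarrow> P (of_word [l] + x)"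
  shows "P x"
proof -
  have "P (of_word w)" for w
  proof (induction w)
    case (Cons l w)
    then have "P (of_word [l] + of_word w)" by (rule assms(2))
    then show ?case by (simp only: of_word_Cons[of l w])
  qed (simp add: assms(1))
  from this[of "word x"] show ?thesis by simp
qed

section \<open>Homomorphisms and the universal property\<close>

definition hom_add :: "('a::plus \<Rightarrow> 'b::plus) \<Rightarrow> bool" where
  "hom_add h \<longleftrightarrow> (\<forall>x y. h (x + y) = h x + h y)"

lemma hom_addD: "hom_add h \<Longrightarrow> h (x + y) = h x + h y"
  by (simp add: hom_add_def)

lemma hom_add_0: "hom_add h \<Longrightarrow> h 0 = 0"
  for h :: "'a::group_add \<Rightarrow> 'b::group_add"
proof -
  assume "hom_add h"
  then have "h 0 + h 0 = h 0 + 0" using hom_addD[of h 0 0] by simp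
  then show ?thesis by (rule add_left_imp_eq)
qed

lemma hom_add_uminus: "hom_add h \<Longrightarrow> h (- x) = - h x"
  for h :: "'a::group_add \<Rightarrow> 'b::group_add"
  using hom_addD[of h "- x" x] by (simp add: hom_add_0 eq_neg_iff_add_eq_0)

lemma hom_add_diff: "hom_add h \<Longrightarrow> h (x - y) = h x - h y"
  for h :: "'a::group_add \<Rightarrow> 'b::group_add"
  by (simp only: diff_conv_add_uminus hom_addD hom_add_uminus)

lemma hom_add_comp: "hom_add g \<Longrightarrow> hom_add h \<Longrightarrow> hom_add (\<lambda>x. g (h x))"
  by (simp add: hom_add_def)

definition letter_val :: "('a \<Rightarrow> 'g::group_add) \<Rightarrow> 'a letter \<Rightarrow> 'g" where
  "letter_val f l = (if snd l then f (fst l) else - f (fst l))"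

definition lift :: "('a \<Rightarrow> 'g::group_add) \<Rightarrow> 'a fgroup \<Rightarrow> 'g" where
  "lift f x = sum_list (map (letter_val f) (word x))"

lemma letter_val_inv [simp]: "letter_val f (inv_letter l) = - letter_val f l"
  by (cases l) (auto simp: letter_val_def inv_letter_def)

lemma sum_letter_val_cons_cancel:
  "sum_list (map (letter_val f) (cons_cancel l w)) = letter_val f l + sum_list (map (letter_val f) w)"
  by (cases w) (auto simp: add.assoc[symmetric])

lemma sum_letter_val_reduce:
  "sum_list (map (letter_val f) (reduce w)) = sum_list (map (letter_val f) w)"
  by (induction w) (auto simp: reduce_def sum_letter_val_cons_cancel)

lemma lift_of_word: "lift f (of_word w) = sum_list (map (letter_val f) w)"
  by (simp add: lift_def word_of_word sum_letter_val_reduce)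

lemma hom_lift: "hom_add (lift f)"
  unfolding hom_add_def
  by (metis lift_of_word map_append of_word_append of_word_word sum_list_append)

lemmas lift_add = hom_addD[OF hom_lift] and lift_uminus = hom_add_uminus[OF hom_lift]
  and lift_diff = hom_add_diff[OF hom_lift] and lift_0 [simp] = hom_add_0[OF hom_lift]

lemma lift_gen [simp]: "lift f (gen s) = f s"
  by (simp add: gen_def lift_of_word letter_val_def)

lemma hom_eqI:
  fixes g h :: "'a fgroup \<Rightarrow> 'g::group_add"
  assumes "hom_add g" "hom_add h" "\<And>s. g (gen s) = h (gen s)"
  shows "g x = h x"
proof (induction x rule: fgroup_induct)
  case (add l x)
  then show ?case
    using assms by (simp add: hom_addD of_word_single hom_add_uminus)
qed (simp add: assms hom_add_0)


section \<open>Length and cancellation\<close>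

definition len :: "'a fgroup \<Rightarrow> nat" where
  "len x = length (word x)"

lemma len_0 [simp]: "len 0 = 0"
  by (simp add: len_def)

lemma len_eq_0 [simp]: "len x = 0 \<longleftrightarrow> x = 0"
  by (metis len_0 len_def length_0_conv of_word_Nil of_word_word)

lemma len_pos: "x \<noteq> 0 \<Longrightarrow> 0 < len x"
  by (metis gr0I len_eq_0)

lemma len_uminus [simp]: "len (- x) = len x"
  by (simp add: len_def word_uminus)

lemma length_cons_cancel: "length (cons_cancel x w) \<le> Suc (length w)"
  by (cases w) auto

lemma length_reduce: "length (reduce w) \<le> length w"
proof (induction w)
  case (Cons x w)
  then show ?case using length_cons_cancel[of x "reduce w"] by (simp add: reduce_def)
qed (simp add: reduce_def)

lemma len_of_word: "len (of_word w) \<le> length w"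
  by (simp add: len_def word_of_word length_reduce)

lemma len_add: "len (x + y) \<le> len x + len y"
  using len_of_word[of "word x @ word y"] by (simp add: plus_fgroup_def len_def)

section \<open>Common suffixes and the tree metric\<close>

fun lcp :: "'a list \<Rightarrow> 'a list \<Rightarrow> nat" where
  "lcp (x # xs) (y # ys) = (if x = y then Suc (lcp xs ys) else 0)"
| "lcp _ _ = 0"

lemma lcp_ultrametric: "min (lcp xs ys) (lcp ys zs) \<le> lcp xs zs"
proof (induction xs ys arbitrary: zs rule: lcp.induct)
  case (1 x xs y ys)
  show ?case using "1.IH" by (cases zs) auto
qed auto

lemma lcp_commute: "lcp xs ys = lcp ys xs"
  by (induction xs ys rule: lcp.induct) auto

lemma take_lcp: "take (lcp xs ys) xs = take (lcp xs ys) ys"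
  by (induction xs ys rule: lcp.induct) auto

lemma lcp_le: "lcp xs ys \<le> length xs" "lcp xs ys \<le> length ys"
  by (induction xs ys rule: lcp.induct) auto

text \<open>For the right-invariant word metric \<open>len (x - y)\<close> this is the Gromov
  product of \<open>x\<close> and \<open>y\<close> at \<open>0\<close>. Its ultrametric inequality
  expresses that the Cayley graph is a tree.\<close>

definition common :: "'a fgroup \<Rightarrow> 'a fgroup \<Rightarrow> nat" where
  "common x y = lcp (rev (word x)) (rev (word y))"

lemma common_ultrametric: "min (common x y) (common y z) \<le> common x z"
  by (simp add: common_def lcp_ultrametric)

lemma common_commute: "common x y = common y x"
  by (simp add: common_def lcp_commute)

lemma reduce_cancel: "reduce (u @ l # inv_letter l # v) = reduce (u @ v)"
proof -
  have "reduce (l # inv_letter l # v) = reduce v"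
    using cons_cancel_inverse[OF reduced_reduce, of l v] by (simp add: reduce_def)
  then show ?thesis by (simp add: reduce_append)
qed

text \<open>The words enter reversed, so that the letters cancelling at the junction are the heads
  and the induction along \<open>lcp\<close> removes them in pairs.\<close>

lemma length_reduce_lcp:
  "reduced (rev xs) \<Longrightarrow> reduced (rev ys) \<Longrightarrow>
     length (reduce (rev xs @ map inv_letter ys)) + 2 * lcp xs ys = length xs + length ys"
proof (induction xs ys rule: lcp.induct)
  case (1 x xs y ys)
  show ?case
  proof (cases "x = y")
    case True
    have "reduced (rev xs)" "reduced (rev ys)"
      using 1 by (auto simp: reduced_append)
    with 1 True show ?thesis by (simp add: reduce_cancel)
  next
    case False
    have "reduced (map inv_letter (y # ys))"
      using reduced_inv_word[OF "1.prems"(2)] by (simp add: rev_map)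
    then have "reduced (rev (x # xs) @ map inv_letter (y # ys))"
      using "1.prems"(1) False
      unfolding reduced_append[of "rev (x # xs)"] by (auto simp: inv_letter_eq_iff)
    from reduce_reduced[OF this] show ?thesis using False by simp
  qed
next
  case ("2_1" v)
  have "reduced (map inv_letter v)"
    using reduced_inv_word[OF "2_1"(2)] by (simp add: rev_map)
  then show ?case by (simp add: reduce_reduced)
next
  case ("2_2" v)
  then show ?case by (simp add: reduce_reduced)
qed

lemma len_diff: "len (x - y) + 2 * common x y = len x + len y"
proof -
  have "word (x - y) = reduce (rev (rev (word x)) @ map inv_letter (rev (word y)))"
    by (simp only: diff_conv_add_uminus plus_fgroup_def word_of_word word_uminus
        reduce_reduce_right rev_rev_ident rev_map)
  then show ?thesis
    using length_reduce_lcp[of "rev (word x)" "rev (word y)"] by (simp add: len_def common_def)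
qed

lemma len_add_common: "len (x + y) + 2 * common x (- y) = len x + len y"
  using len_diff[of x "- y"] by simp

lemma common_suffix:
  obtains u v s where "word x = u @ s" "word y = v @ s" "length s = common x y"
proof -
  let ?k = "common x y"
  have t: "take ?k (rev (word x)) = take ?k (rev (word y))"
    unfolding common_def by (rule take_lcp)
  have l: "?k \<le> length (word x)" "?k \<le> length (word y)"
    using lcp_le[of "rev (word x)" "rev (word y)"] by (simp_all add: common_def)
  have "drop (length (word x) - ?k) (word x) = drop (length (word y) - ?k) (word y)"
    using t by (simp add: take_rev)
  then show thesis
    using that[of "take (length (word x) - ?k) (word x)" "drop (length (word x) - ?k) (word x)"
        "take (length (word y) - ?k) (word y)"] l
    by (metis append_take_drop_id diff_diff_cancel length_drop)
qed

text \<open>If half of \<open>x\<close> cancelled in \<open>x + x\<close>, each letter in the second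
  half of the word would be inverse to its mirror image. In the middle this yields two adjacent
  inverse letters or a letter that is its own inverse.\<close>

lemma len_double:
  assumes "x \<noteq> 0" shows "2 * common x (- x) < len x"
proof (rule ccontr)
  assume neg: "\<not> ?thesis"
  let ?w = "word x" let ?n = "length ?w"
  obtain u v s where s: "?w = u @ s" "word (- x) = v @ s" "length s = common x (- x)"
    by (rule common_suffix)
  have n: "?n > 0" using assms len_eq_0[of x] unfolding len_def by linarith
  have lv: "length v = length u"
    using s arg_cong[OF word_uminus[of x], of length] by simp
  have *: "?w ! j = inv_letter (?w ! (?n - 1 - j))" if "length u \<le> j" "j < ?n" for j
  proof -
    have "?w ! j = (v @ s) ! j" using s that lv by (simp add: nth_append)
    also have "\<dots> = inv_letter (?w ! (?n - 1 - j))"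
      using that s(2) by (simp add: word_uminus rev_nth flip: s(2))
    finally show ?thesis .
  qed
  have k: "2 * length u \<le> ?n" using neg s by (simp add: len_def)
  show False
  proof (cases "even ?n")
    case True
    then obtain i where i: "?n = 2 * i" by blast
    with n obtain i' where i': "i = Suc i'" by (cases i) auto
    have "?w ! i = inv_letter (?w ! i')" using *[of i] k i i' by simp
    moreover have "?w ! Suc i' \<noteq> inv_letter (?w ! i')"
      using reduced_word[of x] i i' unfolding reduced_def successively_conv_nth by auto
    ultimately show False using i' by simp
  next
    case False
    then obtain i where i: "?n = 2 * i + 1" by (elim oddE)
    have "?w ! i = inv_letter (?w ! i)" using *[of i] k i by simp
    then show False by simp
  qed
qed

section \<open>Nielsen's theorem in rank two\<close>

definition pair :: "'b \<Rightarrow> 'b \<Rightarrow> bool \<Rightarrow> 'b" where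
  "pair u v s = (if s then u else v)"

abbreviation hom2 :: "'g::group_add \<Rightarrow> 'g \<Rightarrow> bool fgroup \<Rightarrow> 'g" where
  "hom2 u v \<equiv> lift (pair u v)"

lemma pair_simps [simp]: "pair u v True = u" "pair u v False = v"
  by (simp_all add: pair_def)

lemma hom2_eqI:
  fixes g h :: "bool fgroup \<Rightarrow> 'g::group_add"
  assumes "hom_add g" "hom_add h" "g (gen True) = h (gen True)" "g (gen False) = h (gen False)"
  shows "g x = h x"
proof (rule hom_eqI)
  show "g (gen s) = h (gen s)" for s by (cases s) (use assms in simp_all)
qed (use assms in simp_all)

lemma hom2_hom: "hom_add h \<Longrightarrow> h (hom2 u v x) = hom2 (h u) (h v) x"
  by (rule hom2_eqI) (simp_all add: hom_add_comp hom_lift)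

lemma hom_conj: "hom_add (\<lambda>x. r + x - r)" for r :: "'g::group_add"
  by (simp add: hom_add_def diff_conv_add_uminus add.assoc del: add_uminus_conv_diff)

text \<open>The conjugations are products of the other moves when \<open>u\<close> and \<open>v\<close> generate the group, but
  having them as moves makes a pair of minimal length Nielsen reduced without any tie-breaking.\<close>

inductive nielsen :: "'g::group_add \<Rightarrow> 'g \<Rightarrow> 'g \<Rightarrow> 'g \<Rightarrow> bool" for u v where
  refl: "nielsen u v u v"
| swap: "nielsen u v x y \<Longrightarrow> nielsen u v y x"
| neg: "nielsen u v x y \<Longrightarrow> nielsen u v (- x) y"
| add: "nielsen u v x y \<Longrightarrow> nielsen u v (x + y) y"
| conj: "nielsen u v x y \<Longrightarrow> nielsen u v (r + x - r) (r + y - r)"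

lemma nielsen_trans: "nielsen x y z w \<Longrightarrow> nielsen u v x y \<Longrightarrow> nielsen u v z w"
  by (induction rule: nielsen.induct) (auto intro: nielsen.intros)

lemma nielsen_neg2: "nielsen u v x y \<Longrightarrow> nielsen u v x (- y)"
  by (blast intro: nielsen.intros)

lemma nielsen_diff: "nielsen u v x y \<Longrightarrow> nielsen u v (x - y) y"
  using nielsen_neg2[OF nielsen.add[OF nielsen_neg2[of u v x y]]] by simp

lemma nielsen_add2: "nielsen u v x y \<Longrightarrow> nielsen u v x (x + y)"
proof -
  assume "nielsen u v x y"
  then have "nielsen u v (- y) (- x)" by (blast intro: nielsen.intros)
  from nielsen.neg[OF nielsen.add[OF this]] show ?thesis using nielsen_neg2[of u v "x + y" "- x"]
    by (simp add: minus_add nielsen.swap)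
qed

text \<open>Every move is undone by moves. A reduction of a pair to the generators thus becomes a
  path from the generators to the pair, the direction in which invariance is proved later.\<close>

lemma nielsen_sym: "nielsen u v x y \<Longrightarrow> nielsen x y u v"
proof (induction rule: nielsen.induct)
  case refl
  show ?case by (rule nielsen.refl)
next
  case (swap x y)
  from swap.IH nielsen.swap[OF nielsen.refl] show ?case by (rule nielsen_trans)
next
  case (neg x y)
  have "nielsen (- x) y x y" using nielsen.neg[OF nielsen.refl, of "- x" y] by simp
  with neg.IH show ?case by (rule nielsen_trans)
next
  case (add x y)
  have "nielsen (x + y) y x y" using nielsen_diff[OF nielsen.refl, of "x + y" y] by simp
  with add.IH show ?case by (rule nielsen_trans)
next
  case (conj x y r)
  have "nielsen (r + x - r) (r + y - r) (- r + (r + x - r) - - r) (- r + (r + y - r) - - r)"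
    by (intro nielsen.conj nielsen.refl)
  then have "nielsen (r + x - r) (r + y - r) x y"
    by (simp add: diff_conv_add_uminus add.assoc del: add_uminus_conv_diff)
  with conj.IH show ?case by (rule nielsen_trans)
qed

section \<open>Generating pairs\<close>

definition generates :: "'g::group_add \<Rightarrow> 'g \<Rightarrow> bool" where
  "generates u v \<longleftrightarrow> range (hom2 u v) = UNIV"

lemma range_hom2_mono:
  assumes "x \<in> range (hom2 u v)" "y \<in> range (hom2 u v)"
  shows "range (hom2 x y) \<subseteq> range (hom2 u v)"
proof -
  obtain x' y' where "x = hom2 u v x'" "y = hom2 u v y'" using assms by blast
  then have "hom2 x y z = hom2 u v (hom2 x' y' z)" for z
    by (simp add: hom2_hom[OF hom_lift])
  then show ?thesis by auto
qed

lemma generatesI: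
  assumes "generates x y" "hom2 u v x' = x" "hom2 u v y' = y"
  shows "generates u v"
  using range_hom2_mono[of x u v y] assms unfolding generates_def by blast

lemma generates_nielsen: "nielsen u v x y \<Longrightarrow> generates u v \<Longrightarrow> generates x y"
proof (induction rule: nielsen.induct)
  case (swap x y)
  then show ?case by (intro generatesI[of x y y x "gen False" "gen True"]) auto
next
  case (neg x y)
  then show ?case by (intro generatesI[of x y "-x" y "- gen True" "gen False"]) (auto simp: lift_uminus)
next
  case (add x y)
  then show ?case
    by (intro generatesI[of x y "x+y" y "gen True - gen False" "gen False"]) (auto simp: lift_diff)
next
  case (conj x y r)
  have "z \<in> range (hom2 (r + x - r) (r + y - r))" for z
  proof -
    obtain w where "hom2 x y w = - r + z + r"
      using conj unfolding generates_def by (metis UNIV_I imageE)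
    then have "hom2 (r + x - r) (r + y - r) w = r + (- r + z + r) - r"
      by (simp flip: hom2_hom[OF hom_conj])
    also have "\<dots> = z" by (simp add: diff_conv_add_uminus add.assoc del: add_uminus_conv_diff)
    finally show ?thesis by blast
  qed
  then show ?case by (auto simp: generates_def)
qed

lemma commute_hom2:
  assumes "c + u = u + c" "c + v = v + c"
  shows "c + hom2 u v x = hom2 u v x + c"
proof (induction x rule: fgroup_induct)
  case (add l x)
  have neg: "c + - t = - t + c" if "c + t = t + c" for t
    using that by (metis add.assoc add.right_inverse add.left_inverse add_0 add.right_neutral)
  have "c + hom2 u v (of_word [l]) = hom2 u v (of_word [l]) + c"
    using assms neg by (auto simp: of_word_single lift_uminus pair_def)
  then have "c + (hom2 u v (of_word [l]) + hom2 u v x) = hom2 u v (of_word [l]) + (c + hom2 u v x)"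
    by (simp flip: add.assoc)
  also have "\<dots> = hom2 u v (of_word [l]) + hom2 u v x + c"
    by (simp only: add.IH add.assoc)
  finally show ?case by (simp only: lift_add)
qed simp

lemma gen_noncommute: "gen True + gen False \<noteq> gen False + gen True"
proof
  assume "gen True + gen False = gen False + gen True"
  then have "word (of_word [(True, True), (False, True)]) = word (of_word [(False, True), (True, True)])"
    using of_word_append[of "[(True, True)]" "[(False, True)]"]
      of_word_append[of "[(False, True)]" "[(True, True)]"] by (simp add: gen_def)
  then show False by (simp add: word_of_word reduce_def inv_letter_def)
qed

text \<open>If \<open>u\<close> and \<open>v\<close> commute, so does everything in the range of
  \<open>hom2 u v\<close>, but the free generators do not. This rules out all degenerate pairs at
  once: trivial, equal or mutually inverse entries.\<close>

lemma generates_noncommute: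
  fixes u v :: "bool fgroup"
  assumes "generates u v" shows "u + v \<noteq> v + u"
proof
  assume uv: "u + v = v + u"
  obtain x y where xy: "gen True = hom2 u v x" "gen False = hom2 u v y"
    using assms unfolding generates_def by (metis UNIV_I imageE)
  have "hom2 u v x + u = u + hom2 u v x" "hom2 u v x + v = v + hom2 u v x"
    using commute_hom2[of u u v x] commute_hom2[of v u v x] uv by simp_all
  then have "hom2 u v x + hom2 u v y = hom2 u v y + hom2 u v x"
    by (rule commute_hom2)
  with xy gen_noncommute show False by simp
qed

section \<open>Nielsen reduced pairs\<close>

abbreviation cancel :: "'a fgroup \<Rightarrow> 'a fgroup \<Rightarrow> nat" where
  "cancel x y \<equiv> common x (- y)"

text \<open>The hypotheses say that \<open>S\<close> is Nielsen reduced: \<open>cancel x y\<close>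
  letters are lost on each side of a junction, and no factor is used up by its neighbours. Hence
  every factor leaves at least one letter in the product.\<close>

lemma length_le_len_sum_list:
  fixes S :: "'a fgroup set"
  assumes nz: "0 \<notin> S"
    and half: "\<And>x y. x \<in> S \<Longrightarrow> y \<in> S \<Longrightarrow> x + y \<noteq> 0 \<Longrightarrow>
      2 * cancel x y \<le> len x \<and> 2 * cancel x y \<le> len y"
    and mid: "\<And>x y z. x \<in> S \<Longrightarrow> y \<in> S \<Longrightarrow> z \<in> S \<Longrightarrow> x + y \<noteq> 0 \<Longrightarrow> y + z \<noteq> 0 \<Longrightarrow>
      cancel x y + cancel y z < len y"
    and xs: "set xs \<subseteq> S" "successively (\<lambda>x y. x + y \<noteq> 0) xs"
  shows "length xs \<le> len (sum_list xs)"
proof -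
  \<comment> \<open>Here \<open>e\<close> is the number of letters that the last factor
    \<open>x\<close> loses to its left neighbour, 0 if there is none. The invariant: the common
    suffix of the product and \<open>x\<close> consists of exactly the other letters of
    \<open>x\<close>, and at least one letter per earlier factor precedes it.\<close>
  have main: "common (sum_list (xs @ [x])) x + e = len x \<and>
      length xs + len x \<le> len (sum_list (xs @ [x])) + e"
    if "set (xs @ [x]) \<subseteq> S" "successively (\<lambda>x y. x + y \<noteq> 0) (xs @ [x])"
      "e = (if xs = [] then 0 else cancel (last xs) x)" for xs x e
    using that
  proof (induction xs arbitrary: x e rule: rev_induct)
    case Nil
    then show ?case using len_diff[of x x] by simp
  next
    case (snoc z ys)
    define e' where "e' = (if ys = [] then 0 else cancel (last ys) z)"
    define g where "g = sum_list (ys @ [z])"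
    have S: "z \<in> S" "x \<in> S" "z + x \<noteq> 0" and succ: "successively (\<lambda>x y. x + y \<noteq> 0) (ys @ [z])"
      using snoc.prems by (auto simp: successively_append_iff)
    have IH: "common g z + e' = len z" "length ys + len z \<le> len g + e'"
      using snoc.IH[of z e'] snoc.prems(1) succ by (simp_all add: e'_def g_def)
    have e: "e = cancel z x" using snoc.prems by simp
    have "len z > 0" using S nz by (metis len_pos)
    \<comment> \<open>Something of \<open>z\<close> survives on both sides. The first factor has no
      left neighbour, so \<open>half\<close> replaces \<open>mid\<close> there.\<close>
    have lt: "e' + e < len z"
    proof (cases "ys = []")
      case True
      then show ?thesis using half[OF S] \<open>len z > 0\<close> by (simp add: e e'_def)
    next
      case False
      then have "last ys \<in> S" "last ys + z \<noteq> 0"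
        using snoc.prems(1) succ by (auto simp: successively_append_iff)
      then show ?thesis using mid[of "last ys" z x] S False by (simp add: e e'_def)
    qed
    \<comment> \<open>The product \<open>g\<close> shares more of its end with \<open>z\<close> than
      \<open>z\<close> shares with \<open>- x\<close>. In an ultrametric the third value then equals
      the smaller one, so \<open>x\<close> cancels against \<open>g\<close> just as against
      \<open>z\<close>.\<close>
    have "cancel g x = e"
      using common_ultrametric[of g z "- x"] common_ultrametric[of z g "- x"] lt IH(1)
      by (simp add: e common_commute[of z g])
    moreover have sum: "sum_list ((ys @ [z]) @ [x]) = g + x" by (simp add: g_def add.assoc)
    ultimately show ?case
      unfolding sum using len_add_common[of g x] len_diff[of "g + x" x] IH lt by simp
  qed
  show ?thesis
  proof (cases xs rule: rev_cases)
    case (snoc ys y)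
    define e where "e = (if ys = [] then 0 else cancel (last ys) y)"
    have *: "common (sum_list xs) y + e = len y" "length ys + len y \<le> len (sum_list xs) + e"
      using main[of ys y e] xs by (auto simp: snoc e_def)
    have "y \<in> S" using xs snoc by auto
    then have "len y > 0" using nz by (metis len_pos)
    have "e < len y"
    proof (cases "ys = []")
      case True
      then show ?thesis using \<open>len y > 0\<close> by (simp add: e_def)
    next
      case False
      then have l: "last ys \<in> S" "last ys + y \<noteq> 0"
        using xs by (auto simp: successively_append_iff snoc)
      then show ?thesis using half[OF l(1) \<open>y \<in> S\<close> l(2)] \<open>len y > 0\<close> False by (simp add: e_def)
    qed
    then show ?thesis using * by (simp add: snoc)
  qed simp
qed

text \<open>The exceptional case in which \<open>x\<close> cancels exactly half of \<open>y\<close>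
  from either side. Then \<open>y = P + R\<close> and \<open>x = - R + m - P\<close>, where
  \<open>P\<close> and \<open>R\<close> come from words of half the length of \<open>y\<close>.
  Conjugation by \<open>R\<close> turns \<open>y\<close> into \<open>R + P\<close> and
  \<open>x + y\<close> into \<open>m\<close>, which saves at least \<open>len y\<close>.\<close>

lemma conj_shorter:
  fixes x y :: "'a fgroup"
  assumes xy: "2 * cancel x y = len y" and yx: "2 * cancel y x = len y"
    and "y \<noteq> 0" and le: "len y \<le> len x"
  obtains r where "len (r + y - r) + len (r + (x + y) - r) < len x + len y"
proof -
  define k where "k = cancel x y"
  obtain X' Y' s where s: "word x = X' @ s" "word (- y) = Y' @ s" "length s = k"
    unfolding k_def by (rule common_suffix)
  obtain Y Z t where t: "word y = Y @ t" "word (- x) = Z @ t" "length t = k"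
    using common_suffix[of y "- x"] xy yx k_def by (metis mult_cancel1 zero_neq_numeral)
  have "Y @ t = inv_word s @ inv_word Y'"
    using word_uminus[of "- y"] s(2) t(1) by simp
  moreover have "length Y = k" using t(1,3) xy by (simp add: len_def k_def)
  ultimately have Y: "Y = inv_word s" using s(3) by (simp add: append_eq_append_conv)
  have x2: "X' @ s = inv_word t @ inv_word Z"
    using word_uminus[of "- x"] s(1) t(2) by simp
  \<comment> \<open>As \<open>x\<close> is at least as long as \<open>y\<close>, that is
    \<open>2 * k\<close>, the pieces of length \<open>k\<close> at its two ends do not
    overlap.\<close>
  have "length X' \<ge> k" using le xy s(1,3) by (simp add: len_def k_def)
  then have "take k X' = inv_word t"
    using arg_cong[OF x2, of "take k"] t(3) by simp
  then obtain M where M: "X' = inv_word t @ M" by (metis append_take_drop_id)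
  define P where "P = - of_word s"
  define R where "R = of_word t"
  define m where "m = of_word M"
  have y: "y = P + R"
    using of_word_word[of y] unfolding t(1) Y of_word_append of_word_inv_word P_def R_def by simp
  have x: "x = - R + m - P"
    using of_word_word[of x] unfolding s(1) M of_word_append of_word_inv_word P_def R_def m_def
    by (simp add: add.assoc)
  have "R + y - R = R + P"
    by (simp add: y diff_conv_add_uminus add.assoc del: add_uminus_conv_diff)
  moreover have "R + (x + y) - R = m"
    by (simp add: x y diff_conv_add_uminus add.assoc del: add_uminus_conv_diff)
  moreover have "len (R + P) \<le> len y"
    using len_add[of R P] len_of_word[of s] len_of_word[of t] s(3) t(3) xy
    by (simp add: P_def R_def k_def)
  moreover have "len m + len y \<le> len x"
    using len_of_word[of M] arg_cong[OF s(1), of length] s(3) t(3) xy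
    by (simp add: M m_def len_def k_def)
  moreover have "len y > 0" using \<open>y \<noteq> 0\<close> by (rule len_pos)
  ultimately show thesis by (intro that[of R]) simp
qed

lemma nielsen_signs:
  assumes "x \<in> {u, - u, v, - v}" "y \<in> {u, - u, v, - v}" "x \<noteq> y" "x + y \<noteq> 0"
  shows "nielsen u v x y"
proof -
  note [intro] = nielsen.refl nielsen.swap nielsen.neg
  have 1: "nielsen u v x y" if "x \<in> {u, - u}" "y \<in> {v, - v}" for x y
    using that nielsen_neg2[of u v] by auto
  have 2: "nielsen u v x y" if "y \<in> {u, - u}" "x \<in> {v, - v}" for x y
    using 1[OF that] by (rule nielsen.swap)
  have "\<not> (x \<in> {u, - u} \<and> y \<in> {u, - u})" "\<not> (x \<in> {v, - v} \<and> y \<in> {v, - v})"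
    using assms(3,4) by auto
  then show ?thesis using 1[of x y] 2[of y x] assms(1,2) by blast
qed

text \<open>The first claim holds because replacing an entry by \<open>x + y\<close> does not
  shorten the pair. If the second fails, both neighbours cancel exactly half of \<open>y\<close>, so
  by \<open>len_double\<close> neither is \<open>y\<close> and \<open>z\<close> is \<open>x\<close>
  or \<open>- x\<close>. For \<open>z = - x\<close> the words of \<open>y\<close> and
  \<open>- y\<close> would share half their length, against \<open>len_double\<close>; for
  \<open>z = x\<close> the conjugation of \<open>conj_shorter\<close> contradicts
  minimality.\<close>

lemma minimal_pair:
  fixes u v :: "'a fgroup"
  defines "S \<equiv> {u, - u, v, - v}"
  assumes nz: "u \<noteq> 0" "v \<noteq> 0"
    and min: "\<And>x y. nielsen u v x y \<Longrightarrow> len u + len v \<le> len x + len y"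
  shows minimal_pair_half: "\<And>x y. x \<in> S \<Longrightarrow> y \<in> S \<Longrightarrow> x + y \<noteq> 0 \<Longrightarrow>
      2 * cancel x y \<le> len x \<and> 2 * cancel x y \<le> len y" (is "\<And>x y. _ \<Longrightarrow> _ \<Longrightarrow> _ \<Longrightarrow> ?half x y")
    and minimal_pair_mid: "\<And>x y z. x \<in> S \<Longrightarrow> y \<in> S \<Longrightarrow> z \<in> S \<Longrightarrow> x + y \<noteq> 0 \<Longrightarrow> y + z \<noteq> 0 \<Longrightarrow>
      cancel x y + cancel y z < len y"
proof -
  have S0: "x \<noteq> 0" if "x \<in> S" for x using that nz by (auto simp: S_def)
  have total: "len x + len y = len u + len v" if "x \<in> S" "y \<in> S" "x \<noteq> y" "x + y \<noteq> 0" for x y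
    using that by (auto simp: S_def)
  show half: "?half x y" if "x \<in> S" "y \<in> S" "x + y \<noteq> 0" for x y
  proof (cases "x = y")
    case True
    then show ?thesis using len_double[of x] S0 that by auto
  next
    case False
    have n: "nielsen u v x y" using nielsen_signs that False unfolding S_def by blast
    show ?thesis
      using min[OF nielsen.add[OF n]] min[OF nielsen_add2[OF n]] total[OF that(1,2) False that(3)]
        len_add_common[of x y] by simp
  qed
  show "cancel x y + cancel y z < len y"
    if "x \<in> S" "y \<in> S" "z \<in> S" "x + y \<noteq> 0" "y + z \<noteq> 0" for x y z
  proof (rule ccontr)
    assume "\<not> ?thesis"
    then have eq: "2 * cancel x y = len y" "2 * cancel y z = len y"
      using half[of x y] half[of y z] that by auto
    have "2 * cancel y y < len y" using len_double S0 that by blast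
    then have ne: "x \<noteq> y" "z \<noteq> y" using eq by auto
    have "z = x \<or> z = - x"
      using that ne by (auto simp: S_def)
    then show False
    proof
      assume "z = - x"
      then have "min (common y x) (common x (- y)) * 2 = len y" using eq by simp
      then show False
        using common_ultrametric[of y x "- y"] \<open>2 * cancel y y < len y\<close> by simp
    next
      assume "z = x"
      with eq have yx: "2 * cancel y x = len y" by simp
      have le: "len y \<le> len x" using half[of x y] that eq by auto
      have y0: "y \<noteq> 0" using S0 that by blast
      obtain r where r: "len (r + y - r) + len (r + (x + y) - r) < len x + len y"
        using conj_shorter[OF eq(1) yx y0 le] .
      have "nielsen u v x y" using nielsen_signs that ne unfolding S_def by blast
      then have "nielsen u v (r + y - r) (r + (x + y) - r)"
        by (intro nielsen.conj nielsen.swap[OF nielsen.add])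
      from min[OF this] r total[OF that(1,2) ne(1) that(4)] show False by simp
    qed
  qed
qed

text \<open>A pair of least total length among those reachable from \<open>(u, v)\<close> is Nielsen
  reduced, so a reduced word of \<open>n\<close> letters in it has length at least \<open>n\<close>.
  The generators have length 1 and are therefore entries of the pair up to sign.\<close>

theorem nielsen_generates:
  fixes u v :: "bool fgroup"
  assumes "generates u v"
  shows "nielsen u v (gen True) (gen False)"
proof -
  define P where "P = (\<lambda>(x, y). nielsen u v x y)"
  have "P (u, v)" by (simp add: P_def nielsen.refl)
  then obtain p where p: "P p" "\<And>q. P q \<Longrightarrow> len (fst p) + len (snd p) \<le> len (fst q) + len (snd q)"
    using ex_has_least_nat[of P "(u, v)" "\<lambda>p. len (fst p) + len (snd p)"] by blast
  obtain x y where xy: "p = (x, y)" by (cases p)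
  have n: "nielsen u v x y" using p(1) by (simp add: P_def xy)
  have min: "len x + len y \<le> len x' + len y'" if "nielsen x y x' y'" for x' y'
    using p(2)[of "(x', y')"] nielsen_trans[OF that n] by (simp add: P_def xy)
  have g: "generates x y" using generates_nielsen[OF n assms] .
  then have "x + y \<noteq> y + x" by (rule generates_noncommute)
  then have nz: "x \<noteq> 0" "y \<noteq> 0" "x \<noteq> y" "x \<noteq> - y" "- x \<noteq> y" by auto
  let ?S = "{x, - x, y, - y}" and ?f = "letter_val (pair x y)"
  have S: "?f l \<in> ?S" for l
    by (auto simp: letter_val_def pair_def)
  have self: "z + z \<noteq> 0" if "z \<noteq> 0" for z :: "bool fgroup"
  proof
    assume "z + z = 0"
    then have "- z = z" by (rule minus_unique)
    then have "cancel z z = common z z" by (rule arg_cong)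
    then show False using len_double[OF that] len_diff[of z z] by simp
  qed
  have "x \<noteq> - x" "y \<noteq> - y"
    using self[OF nz(1)] self[OF nz(2)] by (simp_all add: eq_neg_iff_add_eq_0)
  \<comment> \<open>The four elements of \<open>?S\<close> are distinct, so reduced words give
    products without mutually inverse neighbours.\<close>
  then have inj: "l = m" if "?f l = ?f m" for l m
    using that nz(3-5) by (cases l; cases m) (auto simp: letter_val_def pair_def split: if_splits)
  have ne: "?f l + ?f m \<noteq> 0" if "m \<noteq> inv_letter l" for l m
  proof
    assume "?f l + ?f m = 0"
    then have "?f (inv_letter l) = ?f m" by (simp add: minus_unique)
    then show False using inj that by blast
  qed
  have gS: "gen s \<in> ?S" for s
  proof -
    obtain w where w: "gen s = hom2 x y w" using g unfolding generates_def by (metis UNIV_I imageE)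
    have "successively (\<lambda>a b. a + b \<noteq> 0) (map ?f (word w))"
      using reduced_word[of w] ne unfolding reduced_def successively_map
      by (rule successively_mono) auto
    then have "length (map ?f (word w)) \<le> len (sum_list (map ?f (word w)))"
      using S nz minimal_pair[OF nz(1,2) min]
      by (intro length_le_len_sum_list[of ?S]) (auto simp del: insert_iff)
    also have "\<dots> = len (gen s)" using w by (simp add: lift_def)
    also have "\<dots> \<le> 1" using len_of_word[of "[(s, True)]"] by (simp add: gen_def)
    finally have "length (word w) \<le> 1" by simp
    moreover have "word w \<noteq> []"
    proof
      assume "word w = []"
      then have "gen s = (0 :: bool fgroup)" using w by (simp add: lift_def)
      then show False using gen_noncommute by (cases s) auto
    qed
    ultimately obtain l where "word w = [l]" by (cases "word w") auto
    then show ?thesis using w S[of l] by (simp add: lift_def)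
  qed
  have "gen True \<noteq> (gen False :: bool fgroup)" using gen_noncommute by auto
  moreover have "gen True + gen False \<noteq> (0 :: bool fgroup)"
    using gen_noncommute by (metis add.inverse_unique add.left_inverse)
  ultimately have "nielsen x y (gen True) (gen False)"
    using nielsen_signs gS by blast
  then show ?thesis using n by (rule nielsen_trans)
qed

section \<open>Homogenisation\<close>

definition nmul :: "nat \<Rightarrow> 'g::monoid_add \<Rightarrow> 'g" where
  "nmul n x = sum_list (replicate n x)"

lemma nmul_simps [simp]: "nmul 0 x = 0" "nmul (Suc n) x = x + nmul n x"
  by (simp_all add: nmul_def)

lemma nmul_add: "nmul (m + n) x = nmul m x + nmul n x"
  by (simp add: nmul_def replicate_add)

lemma nmul_Suc2: "nmul (Suc n) x = nmul n x + x"
  using nmul_add[of n 1 x] by simp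

lemma nmul_mult: "nmul (m * n) x = nmul m (nmul n x)"
  by (induction m) (simp_all add: nmul_add)

lemma nmul_hom: "hom_add h \<Longrightarrow> h (nmul n x) = nmul n (h x)"
  for h :: "'a::group_add \<Rightarrow> 'b::group_add"
  by (induction n) (simp_all add: hom_add_0 hom_addD)

lemma nmul_uminus: "nmul n (- x) = - nmul n x" for x :: "'a::group_add"
proof (induction n)
  case (Suc n)
  have "nmul (Suc n) (- x) = - nmul n x + - x"
    by (simp only: nmul_Suc2 Suc.IH)
  then show ?case by (simp add: minus_add)
qed simp

section \<open>Functions up to bounded error and quasimorphisms\<close>

definition close :: "('x \<Rightarrow> real) \<Rightarrow> ('x \<Rightarrow> real) \<Rightarrow> bool" where
  "close f g \<longleftrightarrow> (\<exists>C. \<forall>x. \<bar>f x - g x\<bar> \<le> C)"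

lemma closeI: "(\<And>x. \<bar>f x - g x\<bar> \<le> C) \<Longrightarrow> close f g"
  by (auto simp: close_def)

lemma close_refl: "close f f"
  by (rule closeI[of _ _ 0]) simp

lemma close_trans: "close f g \<Longrightarrow> close g h \<Longrightarrow> close f h"
proof -
  assume "close f g" "close g h"
  then obtain C D where C: "\<And>x. \<bar>f x - g x\<bar> \<le> C" and D: "\<And>x. \<bar>g x - h x\<bar> \<le> D"
    unfolding close_def by blast
  have "\<bar>f x - h x\<bar> \<le> C + D" for x
    using C[of x] D[of x] by linarith
  then show ?thesis by (rule closeI)
qed

lemma close_add: "close f g \<Longrightarrow> close f' g' \<Longrightarrow> close (\<lambda>x. f x + f' x) (\<lambda>x. g x + g' x)"
proof -
  assume "close f g" "close f' g'"
  then obtain C D where C: "\<And>x. \<bar>f x - g x\<bar> \<le> C" and D: "\<And>x. \<bar>f' x - g' x\<bar> \<le> D"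
    unfolding close_def by blast
  have "\<bar>f x + f' x - (g x + g' x)\<bar> \<le> C + D" for x
    using C[of x] D[of x] by linarith
  then show ?thesis by (rule closeI)
qed

lemma close_sum:
  assumes "finite A" "\<And>i. i \<in> A \<Longrightarrow> close (f i) (g i)"
  shows "close (\<lambda>x. \<Sum>i\<in>A. f i x) (\<lambda>x. \<Sum>i\<in>A. g i x)"
  using assms by (induction A rule: finite_induct) (auto intro: close_add close_refl)

lemma close_comp: "close f g \<Longrightarrow> close (\<lambda>x. f (h x)) (\<lambda>x. g (h x))"
  by (auto simp: close_def)

definition qm :: "('g::group_add \<Rightarrow> real) \<Rightarrow> bool" where
  "qm f \<longleftrightarrow> (\<exists>D. \<forall>x y. \<bar>f (x + y) - f x - f y\<bar> \<le> D)"

lemma qmI: "(\<And>x y. \<bar>f (x + y) - f x - f y\<bar> \<le> D) \<Longrightarrow> qm f"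
  by (auto simp: qm_def)

lemma qmE:
  assumes "qm f" obtains D where "D \<ge> 0" "\<And>x y. \<bar>f (x + y) - f x - f y\<bar> \<le> D"
proof -
  obtain D where D: "\<And>x y. \<bar>f (x + y) - f x - f y\<bar> \<le> D" using assms by (auto simp: qm_def)
  show thesis using that[OF order_trans[OF abs_ge_zero D]] D by blast
qed

lemma qm_hom: "qm f \<Longrightarrow> hom_add h \<Longrightarrow> qm (\<lambda>x. f (h x))"
  unfolding qm_def by (metis hom_addD)

lemma qm_add: "qm f \<Longrightarrow> qm g \<Longrightarrow> qm (\<lambda>x. f x + g x)"
proof -
  assume "qm f" "qm g"
  then obtain C D where C: "\<And>x y. \<bar>f (x + y) - f x - f y\<bar> \<le> C"
    and D: "\<And>x y. \<bar>g (x + y) - g x - g y\<bar> \<le> D"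
    unfolding qm_def by blast
  have "\<bar>f (x + y) + g (x + y) - (f x + g x) - (f y + g y)\<bar> \<le> C + D" for x y
    using C[of x y] D[of x y] by linarith
  then show ?thesis by (rule qmI)
qed

lemma qm_close:
  assumes "qm f" "close f g" shows "qm g"
proof -
  obtain C D where C: "\<And>x. \<bar>f x - g x\<bar> \<le> C" and D: "\<And>x y. \<bar>f (x + y) - f x - f y\<bar> \<le> D"
    using assms unfolding close_def qm_def by blast
  have "\<bar>g (x + y) - g x - g y\<bar> \<le> D + 3 * C" for x y
    using C[of x] C[of y] C[of "x + y"] D[of x y] by linarith
  then show ?thesis by (rule qmI)
qed

text \<open>The translating factors may vary with \<open>x\<close> as long as they take finitely
  many values; this is what removes coboundary terms later.\<close>

lemma close_translate:
  assumes f: "qm f" and fin: "finite (range r)" "finite (range s)"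
  shows "close (\<lambda>x. f (r x + h x + s x)) (\<lambda>x. f (h x))"
proof -
  obtain D where D: "\<And>x y. \<bar>f (x + y) - f x - f y\<bar> \<le> D" using f by (auto simp: qm_def)
  have bd: "\<bar>f (t x)\<bar> \<le> (\<Sum>y\<in>range t. \<bar>f y\<bar>)" if "finite (range t)" for t and x :: 'x
    using that by (intro member_le_sum) auto
  show ?thesis
  proof (rule closeI)
    fix x
    show "\<bar>f (r x + h x + s x) - f (h x)\<bar>
        \<le> 2 * D + (\<Sum>y\<in>range r. \<bar>f y\<bar>) + (\<Sum>y\<in>range s. \<bar>f y\<bar>)"
      using D[of "r x + h x" "s x"] D[of "r x" "h x"] bd[OF fin(1), of x] bd[OF fin(2), of x]
      by linarith
  qed
qed

lemma close_conj: "qm f \<Longrightarrow> close (\<lambda>x. f (r + h x - r)) (\<lambda>x. f (h x))"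
  using close_translate[of f "\<lambda>_. r" "\<lambda>_. - r" h] by simp

section \<open>The homogenisation and its invariance\<close>

definition homog :: "('g::group_add \<Rightarrow> real) \<Rightarrow> 'g \<Rightarrow> real" where
  "homog f x = lim (\<lambda>n. f (nmul n x) / real n)"

lemma nmul_defect:
  assumes D: "\<And>x y. \<bar>f (x + y) - f x - f y\<bar> \<le> D" and "m > 0"
  shows "\<bar>f (nmul m x) - real m * f x\<bar> \<le> real m * D"
  using \<open>m > 0\<close>
proof (induction m rule: nat_induct_non_zero)
  case 1
  have "0 \<le> D" using order_trans[OF abs_ge_zero D] .
  then show ?case by simp
next
  case (Suc m)
  then show ?case using D[of x "nmul m x"] by (simp add: algebra_simps abs_le_iff)
qed

lemma homog_LIMSEQ:
  assumes "qm f"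
  shows "(\<lambda>n. f (nmul n x) / real n) \<longlonglongrightarrow> homog f x"
proof -
  obtain D where "D \<ge> 0" and D: "\<And>x y. \<bar>f (x + y) - f x - f y\<bar> \<le> D"
    using qmE[OF assms] by metis
  define X where "X = (\<lambda>n. f (nmul n x) / real n)"
  \<comment> \<open>The defect estimate is applied to \<open>m\<close> copies of
    \<open>nmul n x\<close>. Comparing \<open>X m\<close> and \<open>X n\<close> through
    \<open>X (m * n)\<close> then gives the Cauchy property.\<close>
  have *: "\<bar>X (m * n) - X n\<bar> \<le> D / n" if "m > 0" "n > 0" for m n
  proof -
    have "\<bar>X (m * n) - X n\<bar> = \<bar>f (nmul m (nmul n x)) - m * f (nmul n x)\<bar> / (m * n)"
      using that by (simp add: X_def nmul_mult field_simps abs_divide)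
    also have "\<dots> \<le> (m * D) / (m * n)"
      using nmul_defect[OF D that(1)] by (intro divide_right_mono) auto
    also have "\<dots> = D / n" using that by simp
    finally show ?thesis .
  qed
  have **: "\<bar>X m - X n\<bar> \<le> D / m + D / n" if "m > 0" "n > 0" for m n
    using *[OF that] *[OF that(2,1)] by (simp add: mult.commute)
  have "Cauchy X"
  proof (rule metric_CauchyI)
    fix e :: real assume "e > 0"
    obtain N :: nat where N: "N > 2 * D / e" using reals_Archimedean2 by blast
    show "\<exists>M. \<forall>m\<ge>M. \<forall>n\<ge>M. dist (X m) (X n) < e"
    proof (intro exI allI impI)
      fix m n assume mn: "m \<ge> Suc N" "n \<ge> Suc N"
      have le: "D / k \<le> D / Suc N" if "k \<ge> Suc N" for k
        using that \<open>D \<ge> 0\<close> by (intro divide_left_mono) auto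
      have "2 * D < e * Suc N" using N \<open>e > 0\<close> by (simp add: field_simps)
      then have "2 * (D / Suc N) < e" by (simp add: field_simps)
      then show "dist (X m) (X n) < e"
        using **[of m n] le[OF mn(1)] le[OF mn(2)] mn by (simp add: dist_real_def)
    qed
  qed
  then have "convergent X" by (rule Cauchy_convergent)
  then show ?thesis unfolding homog_def X_def by (simp add: convergent_LIMSEQ_iff)
qed

lemma LIMSEQ_bounded_over:
  assumes "\<And>n. \<bar>a n\<bar> \<le> (C::real)" shows "(\<lambda>n. a n / real n) \<longlonglongrightarrow> 0"
proof (rule tendsto_0_le[of "\<lambda>n. C / real n" _ _ 1])
  show "(\<lambda>n. C / real n) \<longlonglongrightarrow> 0"
    by (rule lim_const_over_n)
  have "\<bar>a n\<bar> \<le> \<bar>C\<bar>" for n using assms[of n] by simp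
  then show "\<forall>\<^sub>F n in sequentially. norm (a n / real n) \<le> norm (C / real n) * 1"
    by (intro always_eventually allI) (simp add: divide_right_mono abs_divide)
qed

lemma homog_eqI:
  assumes "qm f" and C: "\<And>n. \<bar>f (nmul n x) - real n * c\<bar> \<le> C"
  shows "homog f x = c"
proof -
  have "(\<lambda>n. (f (nmul n x) - real n * c) / real n) \<longlonglongrightarrow> 0"
    by (rule LIMSEQ_bounded_over[OF C])
  then have "(\<lambda>n. (f (nmul n x) - real n * c) / real n + c) \<longlonglongrightarrow> 0 + c"
    by (intro tendsto_intros)
  moreover have "\<forall>\<^sub>F n in sequentially. (f (nmul n x) - real n * c) / real n + c = f (nmul n x) / real n"
    by (rule eventually_mono[OF eventually_gt_at_top[of 0]]) (simp add: field_simps)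
  ultimately have "(\<lambda>n. f (nmul n x) / real n) \<longlonglongrightarrow> c"
    by (simp add: tendsto_cong)
  with homog_LIMSEQ[OF assms(1)] show ?thesis by (rule LIMSEQ_unique)
qed

text \<open>A bounded difference disappears after division by \<open>n\<close>. Invariance of a
  homogenisation therefore needs checking only up to \<open>close\<close>.\<close>

lemma homog_close_eq:
  assumes "qm f" "qm g" "close f g"
  shows "homog f x = homog g x"
proof -
  obtain C where C: "\<And>x. \<bar>f x - g x\<bar> \<le> C" using assms by (auto simp: close_def)
  have "(\<lambda>n. (f (nmul n x) - g (nmul n x)) / real n) \<longlonglongrightarrow> 0"
    by (rule LIMSEQ_bounded_over[OF C])
  moreover have "(\<lambda>n. f (nmul n x) / real n - g (nmul n x) / real n) \<longlonglongrightarrow> homog f x - homog g x"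
    using assms by (intro tendsto_diff homog_LIMSEQ)
  ultimately have "homog f x - homog g x = 0"
    unfolding diff_divide_distrib[symmetric] using LIMSEQ_unique by metis
  then show ?thesis by simp
qed

lemma close_homog:
  assumes "qm f" shows "close f (homog f)"
proof -
  obtain D where D: "\<And>x y. \<bar>f (x + y) - f x - f y\<bar> \<le> D"
    using assms by (auto simp: qm_def)
  show ?thesis
  proof (rule closeI)
    fix x
    have "(\<lambda>n. \<bar>f (nmul n x) / real n - f x\<bar>) \<longlonglongrightarrow> \<bar>homog f x - f x\<bar>"
      using assms by (intro tendsto_intros homog_LIMSEQ)
    moreover have "\<bar>f (nmul n x) / real n - f x\<bar> \<le> D" if "n \<ge> 1" for n
    proof -
      have "\<bar>f (nmul n x) / real n - f x\<bar> = \<bar>f (nmul n x) - n * f x\<bar> / n"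
        using that by (simp add: field_simps abs_divide)
      also have "\<dots> \<le> n * D / n"
        using nmul_defect[OF D, of n x] that by (intro divide_right_mono) auto
      finally show ?thesis using that by simp
    qed
    ultimately have "\<bar>homog f x - f x\<bar> \<le> D"
      by (intro LIMSEQ_le_const2) auto
    then show "\<bar>f x - homog f x\<bar> \<le> D" by (simp add: abs_minus_commute)
  qed
qed

lemma qm_homog: "qm f \<Longrightarrow> qm (homog f)"
  by (rule qm_close[OF _ close_homog])

lemma homog_hom: "hom_add h \<Longrightarrow> homog f (h x) = homog (\<lambda>x. f (h x)) x"
  by (simp add: homog_def nmul_hom)

lemma homog_invariant:
  assumes "qm f" "hom_add h" "close (\<lambda>x. f (h x)) f"
  shows "homog f (h x) = homog f x"
  using assms by (simp add: homog_hom homog_close_eq qm_hom)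

lemma homog_conj: "qm f \<Longrightarrow> homog f (r + x - r) = homog f x"
  using homog_invariant[of f "\<lambda>x. r + x - r"] close_conj[of f r "\<lambda>x. x"]
  by (simp add: hom_add_def diff_conv_add_uminus add.assoc del: add_uminus_conv_diff)

lemma homog_nmul:
  assumes "qm f" shows "homog f (nmul k x) = real k * homog f x"
proof (cases "k = 0")
  case True
  have "nmul n (0 :: 'a) = 0" for n by (induction n) simp_all
  then have "homog f 0 = 0" by (intro homog_eqI[OF assms, of _ _ "\<bar>f 0\<bar>"]) simp
  with True show ?thesis by simp
next
  case False
  then have "strict_mono (\<lambda>n. n * k)" by (simp add: strict_mono_def)
  from LIMSEQ_subseq_LIMSEQ[OF homog_LIMSEQ[OF assms] this]
  have "(\<lambda>n. real k * (f (nmul (n * k) x) / real (n * k))) \<longlonglongrightarrow> real k * homog f x"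
    by (intro tendsto_mult_left) (simp add: comp_def)
  moreover have "(\<lambda>n. real k * (f (nmul (n * k) x) / real (n * k)))
      = (\<lambda>n. f (nmul n (nmul k x)) / real n)"
    using False by (simp add: fun_eq_iff nmul_mult)
  ultimately show ?thesis using LIMSEQ_unique homog_LIMSEQ[OF assms] by metis
qed

lemma homog_uminus:
  assumes "qm f" shows "homog f (- x) = - homog f x"
proof -
  obtain D where D: "\<And>x y. \<bar>f (x + y) - f x - f y\<bar> \<le> D"
    using assms by (auto simp: qm_def)
  have "\<bar>f (nmul n x) + f (nmul n (- x))\<bar> \<le> D + \<bar>f 0\<bar>" for n
    using D[of "nmul n x" "nmul n (- x)"] by (simp add: nmul_uminus)
  then have "(\<lambda>n. (f (nmul n x) + f (nmul n (- x))) / real n) \<longlonglongrightarrow> 0"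
    by (rule LIMSEQ_bounded_over)
  moreover have "(\<lambda>n. f (nmul n x) / real n + f (nmul n (- x)) / real n)
      \<longlonglongrightarrow> homog f x + homog f (- x)"
    by (intro tendsto_add homog_LIMSEQ assms)
  ultimately have "homog f x + homog f (- x) = 0"
    unfolding add_divide_distrib[symmetric] using LIMSEQ_unique by metis
  then show ?thesis by simp
qed

section \<open>Quasimorphisms counting adjacent run lengths\<close>

fun pair_sum :: "(nat \<Rightarrow> nat \<Rightarrow> real) \<Rightarrow> nat list \<Rightarrow> real" where
  "pair_sum l (x # y # xs) = l x y + pair_sum l (y # xs)"
| "pair_sum l _ = 0"

lemma pair_sum_append:
  "xs \<noteq> [] \<Longrightarrow> ys \<noteq> [] \<Longrightarrow> pair_sum l (xs @ ys) = pair_sum l xs + l (last xs) (hd ys) + pair_sum l ys"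
proof (induction l xs rule: pair_sum.induct)
  case ("2_2" l v)
  then show ?case by (cases ys) auto
qed auto

lemma pair_sum_rev:
  assumes "\<And>x y. l y x = - l x y"
  shows "pair_sum l (rev xs) = - pair_sum l xs"
proof (induction xs rule: induct_list012)
  case (3 x y xs)
  then show ?case using pair_sum_append[of "rev (y # xs)" "[x]" l] by (simp add: assms[of x y])
qed auto

lemma pair_sum_append_bound:
  assumes "\<forall>x y. \<bar>l x y\<bar> \<le> 1"
  shows "\<bar>pair_sum l (xs @ ys) - pair_sum l xs - pair_sum l ys\<bar> \<le> 1"
  using assms by (cases "xs = [] \<or> ys = []") (auto simp: pair_sum_append)

section \<open>Run lengths of words\<close>

fun runs :: "'a list \<Rightarrow> nat list" where
  "runs [] = []"
| "runs [x] = [1]"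
| "runs (x # y # xs) = (if x = y then Suc (hd (runs (y # xs))) # tl (runs (y # xs)) else 1 # runs (y # xs))"

lemma runs_eq_Nil [simp]: "runs xs = [] \<longleftrightarrow> xs = []"
  by (induction xs rule: runs.induct) auto

lemma runs_append_neq: "xs = [] \<or> ys = [] \<or> last xs \<noteq> hd ys \<Longrightarrow> runs (xs @ ys) = runs xs @ runs ys"
proof (induction xs rule: runs.induct)
  case (2 x)
  then show ?case by (cases ys) auto
next
  case (3 x y xs)
  then have "runs ((y # xs) @ ys) = runs (y # xs) @ runs ys" by auto
  moreover obtain k ks where "runs (y # xs) = k # ks" by (cases "runs (y # xs)") auto
  ultimately show ?case by simp
qed simp

lemma runs_append_eq:
  assumes "xs \<noteq> []" "ys \<noteq> []" "last xs = hd ys"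
  obtains as j k bs where "runs xs = as @ [j]" "runs ys = k # bs" "runs (xs @ ys) = as @ (j + k) # bs"
proof -
  have "\<exists>as j k bs. runs xs = as @ [j] \<and> runs ys = k # bs \<and> runs (xs @ ys) = as @ (j + k) # bs"
    using assms
  proof (induction xs rule: runs.induct)
    case (2 x)
    then obtain zs where ys: "ys = x # zs" by (cases ys) auto
    obtain k bs where "runs ys = k # bs" using ys by (cases "runs ys") auto
    then show ?case using ys by auto
  next
    case (3 x y xs)
    then obtain as j k bs where *: "runs (y # xs) = as @ [j]" "runs ys = k # bs"
      "runs ((y # xs) @ ys) = as @ (j + k) # bs" by auto
    show ?case
    proof (cases "x = y")
      case False
      then show ?thesis using * by (intro exI[of _ "1 # as"] exI[of _ j] exI[of _ k] exI[of _ bs]) simp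
    next
      case True
      show ?thesis
      proof (cases as)
        case Nil
        then show ?thesis using * True
          by (intro exI[of _ "[]"] exI[of _ "Suc j"] exI[of _ k] exI[of _ bs]) simp
      next
        case (Cons a as')
        then show ?thesis using * True
          by (intro exI[of _ "Suc a # as'"] exI[of _ j] exI[of _ k] exI[of _ bs]) simp
      qed
    qed
  qed simp
  then show thesis using that by blast
qed

lemma runs_rev: "runs (rev xs) = rev (runs xs)"
proof (induction xs rule: runs.induct)
  case (3 x y xs)
  have y: "last (rev (y # xs)) = y" "rev (y # xs) \<noteq> []" by simp_all
  show ?case
  proof (cases "x = y")
    case False
    then show ?thesis
      using 3 runs_append_neq[of "rev (y # xs)" "[x]"] by simp
  next
    case True
    then obtain as j k bs where *: "runs (rev (y # xs)) = as @ [j]" "runs [x] = k # bs"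
      "runs (rev (y # xs) @ [x]) = as @ (j + k) # bs"
      using runs_append_eq[of "rev (y # xs)" "[x]"] y by auto
    moreover have "runs (rev (y # xs)) = rev (runs (y # xs))" using 3 by blast
    ultimately have "runs (y # xs) = rev (as @ [j])" by (metis rev_rev_ident)
    then show ?thesis using * True by simp
  qed
qed auto

lemma runs_map: "inj f \<Longrightarrow> runs (map f xs) = runs xs"
  by (induction xs rule: runs.induct) (auto simp: inj_eq)

lemma runs_replicate: "n > 0 \<Longrightarrow> runs (replicate n x) = [n]"
proof (induction n rule: nat_induct_non_zero)
  case (Suc n)
  then show ?case by (cases n) auto
qed simp

text \<open>At most the two runs at the seam merge. This affects at most four adjacent pairs: the
  two next to the separate runs and the two next to the merged one.\<close>

lemma runs_append_bound:
  assumes l: "\<forall>x y. \<bar>l x y\<bar> \<le> 1"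
  shows "\<bar>pair_sum l (runs (xs @ ys)) - pair_sum l (runs xs) - pair_sum l (runs ys)\<bar> \<le> 4"
proof (cases "xs = [] \<or> ys = [] \<or> last xs \<noteq> hd ys")
  case True
  from runs_append_neq[OF this] show ?thesis
    using pair_sum_append_bound[OF l, where xs = "runs xs" and ys = "runs ys"] by simp
next
  case False
  then obtain as j k bs where *: "runs xs = as @ [j]" "runs ys = k # bs"
    "runs (xs @ ys) = as @ (j + k) # bs"
    by (metis runs_append_eq)
  show ?thesis
    using pair_sum_append_bound[OF l, where xs = as and ys = "[j]"] pair_sum_append_bound[OF l, where xs = "[k]" and ys = bs]
      pair_sum_append_bound[OF l, where xs = as and ys = "[j + k] @ bs"] pair_sum_append_bound[OF l, where xs = "[j + k]" and ys = bs]
    by (simp add: * abs_le_iff)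
qed

section \<open>The counting quasimorphism and its symmetries\<close>

definition run_count :: "(nat \<Rightarrow> nat \<Rightarrow> real) \<Rightarrow> 'a fgroup \<Rightarrow> real" where
  "run_count l x = pair_sum l (runs (word x))"

lemma inj_inv_letter: "inj inv_letter"
  by (rule injI) (metis inv_letter_simps(1))

lemma reduce_eq_self:
  "length (reduce w) = length w \<Longrightarrow> reduce w = w"
proof (induction w)
  case (Cons x w)
  have r: "reduce (x # w) = cons_cancel x (reduce w)" by (simp add: reduce_def)
  have "length (reduce w) = length w"
    using Cons.prems length_cons_cancel[of x "reduce w"] length_reduce[of w] by (simp add: r)
  then have w: "reduce w = w" by (rule Cons.IH)
  show ?case using Cons.prems unfolding r w by (cases w) (auto split: if_splits)
qed (simp add: reduce_def)

text \<open>The cancelling part \<open>s\<close> is the common suffix of \<open>x\<close> and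
  \<open>- y\<close>. By the length formula reduction cannot shorten what remains, so the rest is
  already reduced.\<close>

lemma word_add_decomp:
  obtains p s q where "word x = p @ s" "word y = inv_word s @ q" "word (x + y) = p @ q"
proof -
  obtain p r s where *: "word x = p @ s" "word (- y) = r @ s" "length s = common x (- y)"
    by (rule common_suffix)
  have y: "word y = inv_word s @ inv_word r"
    using word_uminus[of "- y"] *(2) by simp
  have "of_word (p @ inv_word r) = x + y"
  proof -
    have "x = of_word p + of_word s" "y = - of_word s + of_word (inv_word r)"
      using of_word_word[of x] of_word_word[of y]
      by (simp_all only: *(1) y of_word_append of_word_inv_word)
    then show ?thesis by (simp add: of_word_append add.assoc)
  qed
  then have w: "word (x + y) = reduce (p @ inv_word r)" by (metis word_of_word)
  then have "reduce (p @ inv_word r) = p @ inv_word r"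
    using len_add_common[of x y] *(1,3) y by (intro reduce_eq_self) (simp add: len_def)
  with w *(1) y show thesis by (intro that) auto
qed

text \<open>Inversion reverses the sequence of run lengths, so by antisymmetry the contributions of
  the cancelling part \<open>s\<close> and its inverse add up to zero. Three seams remain, each with
  error at most 4.\<close>

lemma qm_run_count:
  assumes l: "\<forall>x y. \<bar>l x y\<bar> \<le> 1" and anti: "\<And>x y. l y x = - l x y"
  shows "qm (run_count l)"
proof (rule qmI[of _ 12])
  fix x y :: "'a fgroup"
  obtain p s q where w: "word x = p @ s" "word y = inv_word s @ q" "word (x + y) = p @ q"
    by (rule word_add_decomp)
  have "pair_sum l (runs (inv_word s)) = - pair_sum l (runs s)"
    by (simp add: runs_rev pair_sum_rev[of l, OF anti] runs_map[OF inj_inv_letter])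
  then show "\<bar>run_count l (x + y) - run_count l x - run_count l y\<bar> \<le> 12"
    using runs_append_bound[OF l, where xs = p and ys = s] runs_append_bound[OF l, where xs = "inv_word s" and ys = q]
      runs_append_bound[OF l, where xs = p and ys = q]
    by (simp add: run_count_def w abs_le_iff)
qed

text \<open>A signed permutation of the generators is an injective map of letters that commutes with
  inversion; it keeps words reduced and preserves their runs.\<close>

lemma run_count_signed:
  assumes "fst a \<noteq> fst b"
  shows "run_count l (hom2 (of_word [a]) (of_word [b]) x) = run_count l x"
proof -
  define \<sigma> where "\<sigma> k = (let c = if fst k then a else b in if snd k then c else inv_letter c)" for k
  have val: "letter_val (pair (of_word [a]) (of_word [b])) k = of_word [\<sigma> k]" for k
    by (auto simp: letter_val_def pair_def \<sigma>_def of_word_inv_letter)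
  have inv: "\<sigma> (inv_letter k) = inv_letter (\<sigma> k)" for k
    by (auto simp: \<sigma>_def inv_letter_def)
  have f: "fst (\<sigma> k) = (if fst k then fst a else fst b)" for k by (simp add: \<sigma>_def)
  have "inj \<sigma>"
  proof (rule injI)
    fix k k' assume eq: "\<sigma> k = \<sigma> k'"
    from arg_cong[OF eq, of fst]
    have "(if fst k then fst a else fst b) = (if fst k' then fst a else fst b)"
      unfolding f .
    then have "fst k = fst k'" using assms by (auto split: if_splits)
    moreover have "snd k = snd k'"
    proof (rule ccontr)
      assume "snd k \<noteq> snd k'"
      then have "\<sigma> k = inv_letter (\<sigma> k')"
        using \<open>fst k = fst k'\<close> by (simp add: \<sigma>_def Let_def)
      then show False using eq by simp
    qed
    ultimately show "k = k'" by (rule prod_eqI)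
  qed
  have "hom2 (of_word [a]) (of_word [b]) (of_word w) = of_word (map \<sigma> w)" for w
  proof (induction w)
    case (Cons k w)
    then show ?case using of_word_Cons[of "\<sigma> k" "map \<sigma> w"] by (simp add: lift_of_word val)
  qed simp
  from this[of "word x"] have "word (hom2 (of_word [a]) (of_word [b]) x) = reduce (map \<sigma> (word x))"
    by (simp add: word_of_word)
  also have "\<dots> = map \<sigma> (word x)"
    using reduced_word[of x]
    by (intro reduce_reduced)
      (simp add: reduced_def successively_map inj_eq[OF \<open>inj \<sigma>\<close>] flip: inv)
  finally show ?thesis by (simp add: run_count_def runs_map[OF \<open>inj \<sigma>\<close>])
qed

text \<open>Words are given as lists of blocks \<open>(l, n)\<close> standing for \<open>l\<^sup>n\<close>.\<close>

definition expand :: "('a \<times> nat) list \<Rightarrow> 'a list" where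
  "expand bs = concat (map (\<lambda>(l, n). replicate n l) bs)"

lemma expand_simps [simp]: "expand [] = []" "expand ((l, n) # bs) = replicate n l @ expand bs"
  "expand (bs @ cs) = expand bs @ expand cs"
  by (simp_all add: expand_def)

lemma hd_expand: "bs \<noteq> [] \<Longrightarrow> \<forall>b\<in>set bs. 0 < snd b \<Longrightarrow> expand bs \<noteq> [] \<and> hd (expand bs) = fst (hd bs)"
  by (cases bs) auto

lemma runs_expand:
  "successively (\<lambda>b c. fst b \<noteq> fst c) bs \<Longrightarrow> \<forall>b\<in>set bs. 0 < snd b \<Longrightarrow> runs (expand bs) = map snd bs"
proof (induction bs)
  case (Cons b bs)
  have "runs (replicate (snd b) (fst b) @ expand bs) = runs (replicate (snd b) (fst b)) @ runs (expand bs)"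
    using Cons.prems hd_expand[of bs]
    by (intro runs_append_neq, cases "bs = []") (auto simp: successively_Cons)
  with Cons show ?case
    by (cases b) (auto simp: successively_Cons runs_replicate)
qed simp

lemma reduced_replicate: "reduced (replicate n l)"
  by (induction n) (auto simp: reduced_Cons)

lemma reduced_expand:
  "successively (\<lambda>b c. fst (fst b) \<noteq> fst (fst c)) bs \<Longrightarrow> \<forall>b\<in>set bs. 0 < snd b \<Longrightarrow> reduced (expand bs)"
proof (induction bs)
  case (Cons b bs)
  have "reduced (replicate (snd b) (fst b) @ expand bs)"
    using Cons hd_expand[of bs]
    by (cases "bs = []") (auto simp: reduced_append reduced_replicate successively_Cons)
  then show ?case by (cases b) simp
qed simp

lemma run_count_expand:
  assumes "successively (\<lambda>b c. fst (fst b) \<noteq> fst (fst c)) bs" "\<forall>b\<in>set bs. 0 < snd b"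
  shows "run_count l (of_word (expand bs)) = pair_sum l (map snd bs)"
proof -
  have "successively (\<lambda>b c. fst b \<noteq> fst c) bs"
    using assms(1) by (rule successively_mono) auto
  then show ?thesis
    using assms by (simp add: run_count_def word_of_reduced reduced_expand runs_expand)
qed

section \<open>The cocycle\<close>

text \<open>
  The four cosets of \<open>K\<close> are the pairs of booleans, the generators toggling one component each.
  The outputs are Schreier generators of \<open>K\<close> with respect to the representatives \<open>1, x, y, z\<close> in
  \<open>\<langle>x, y, z | x\<^sup>2 = y\<^sup>2 = z\<^sup>2 = 1\<rangle> \<ge> F\<^sub>2\<close> (where \<open>a = xy\<close>, \<open>b = yz\<close>), after killing the peripheral
  element \<open>xyz\<close>; the generators of \<open>Q\<close> are the images of \<open>yxz\<close> and \<open>xzy\<close>.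
\<close>

definition step :: "bool \<times> bool \<Rightarrow> bool letter \<Rightarrow> bool \<times> bool" where
  "step v l = (if fst l then (\<not> fst v, snd v) else (fst v, \<not> snd v))"

definition emit :: "bool \<times> bool \<Rightarrow> bool \<Rightarrow> bool fgroup" where
  "emit v s =
     (if s then if fst v then if snd v then gen True else - gen True else 0
      else if snd v then 0 else if fst v then gen False else - gen False)"

text \<open>An inverse letter traverses backwards the edge that starts at \<open>step v l\<close>,
  hence the minus sign and the shifted coset.\<close>

definition letter_output :: "bool \<times> bool \<Rightarrow> bool letter \<Rightarrow> bool fgroup" where
  "letter_output v l = (if snd l then emit v (fst l) else - emit (step v l) (fst l))"

fun word_output :: "bool letter list \<Rightarrow> bool \<times> bool \<Rightarrow> bool fgroup" where
  "word_output [] v = 0"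
| "word_output (l # w) v = letter_output v l + word_output w (step v l)"

lemma step_step_inv [simp]: "step (step v l) (inv_letter l) = v"
  by (cases v) (simp add: step_def)

lemma letter_output_inv [simp]: "letter_output (step v l) (inv_letter l) = - letter_output v l"
  by (cases l) (simp add: letter_output_def, simp add: inv_letter_def step_def)

lemma word_output_append:
  "word_output (u @ w) v = word_output u v + word_output w (foldl step v u)"
  by (induction u arbitrary: v) (simp_all add: add.assoc)

lemma cons_cancel_output:
  "word_output (cons_cancel l w) v = word_output (l # w) v"
  "foldl step v (cons_cancel l w) = foldl step v (l # w)"
  by (cases w; simp add: add.assoc[symmetric])+

lemma reduce_output:
  "word_output (reduce w) v = word_output w v \<and> foldl step v (reduce w) = foldl step v w"
proof (induction w arbitrary: v)
  case (Cons l w)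
  have "reduce (l # w) = cons_cancel l (reduce w)" by (simp add: reduce_def)
  then show ?case by (simp add: cons_cancel_output Cons)
qed (simp add: reduce_def)

definition cocycle :: "bool fgroup \<Rightarrow> bool \<times> bool \<Rightarrow> bool fgroup" where
  "cocycle x = word_output (word x)"

definition act :: "bool fgroup \<Rightarrow> bool \<times> bool \<Rightarrow> bool \<times> bool" where
  "act x v = foldl step v (word x)"

lemma cocycle_0 [simp]: "cocycle 0 v = 0"
  by (simp add: cocycle_def)

lemma act_0 [simp]: "act 0 v = v"
  by (simp add: act_def)

text \<open>On the subgroup \<open>K\<close> of elements that fix all cosets this rule makes
  \<open>cocycle\<close> at each \<open>v\<close> a homomorphism; the four cosets give four such
  maps.\<close>

lemma cocycle_add: "cocycle (x + y) v = cocycle x v + cocycle y (act x v)"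
  by (simp add: cocycle_def act_def plus_fgroup_def word_of_word reduce_output word_output_append)

lemma act_add: "act (x + y) v = act y (act x v)"
  by (simp add: act_def plus_fgroup_def word_of_word reduce_output)

lemma act_uminus [simp]: "act (- x) (act x v) = v" "act x (act (- x) v) = v"
  by (simp_all flip: act_add)

lemma cocycle_uminus: "cocycle (- x) v = - cocycle x (act (- x) v)"
  using cocycle_add[of "- x" x v] by (simp add: eq_neg_iff_add_eq_0)

lemma cocycle_gen [simp]: "cocycle (gen s) v = emit v s"
  by (simp add: cocycle_def gen_def word_of_word reduce_def letter_output_def)

lemma act_gen [simp]: "act (gen s) v = (if s then (\<not> fst v, snd v) else (fst v, \<not> snd v))"
  by (simp add: act_def gen_def word_of_word reduce_def step_def)

lemma act_uminus_gen [simp]: "act (- gen s) v = act (gen s) v"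
proof -
  have "act (gen s) (act (gen s) v) = v" by simp
  then show ?thesis by (metis act_uminus(1))
qed

lemma bij_act: "bij (act x)"
  by (rule bij_betwI[of _ _ _ "act (- x)"]) simp_all

text \<open>An endomorphism \<open>\<psi>\<close> permutes the cosets by \<open>\<sigma>\<close> and
  changes the cocycle by \<open>\<theta>\<close> and the coboundary of \<open>h\<close>. Generators
  suffice, since the \<open>h\<close> terms telescope in sums and the identities pass to
  inverses.\<close>

lemma intertwine:
  assumes \<psi>: "hom_add \<psi>" and \<theta>: "hom_add \<theta>"
    and act: "\<And>s v. act (\<psi> (gen s)) (\<sigma> v) = \<sigma> (act (gen s) v)"
    and coc: "\<And>s v. cocycle (\<psi> (gen s)) (\<sigma> v) = h v + \<theta> (cocycle (gen s) v) - h (act (gen s) v)"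
  shows "act (\<psi> x) (\<sigma> v) = \<sigma> (act x v) \<and>
    cocycle (\<psi> x) (\<sigma> v) = h v + \<theta> (cocycle x v) - h (act x v)"
proof -
  define P where "P x \<longleftrightarrow> (\<forall>v. act (\<psi> x) (\<sigma> v) = \<sigma> (act x v) \<and>
    cocycle (\<psi> x) (\<sigma> v) = h v + \<theta> (cocycle x v) - h (act x v))" for x
  have PD: "act (\<psi> x) (\<sigma> v) = \<sigma> (act x v)"
    "cocycle (\<psi> x) (\<sigma> v) = h v + \<theta> (cocycle x v) - h (act x v)" if "P x" for x v
    using that unfolding P_def by blast+
  have P_add: "P (x + y)" if "P x" "P y" for x y
    unfolding P_def
    by (simp add: PD[OF that(1)] PD[OF that(2)] hom_addD[OF \<psi>] hom_addD[OF \<theta>] act_add cocycle_add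
        diff_conv_add_uminus add.assoc del: add_uminus_conv_diff)
  have uminus: "P (- x)" if "P x" for x
    unfolding P_def
  proof (intro allI conjI)
    fix v
    have 1: "act (- \<psi> x) (\<sigma> v) = \<sigma> (act (- x) v)"
    proof -
      have "act (\<psi> x) (\<sigma> (act (- x) v)) = \<sigma> v" by (simp add: PD[OF that])
      from arg_cong[OF this, of "act (- \<psi> x)"] show ?thesis by simp
    qed
    then show "act (\<psi> (- x)) (\<sigma> v) = \<sigma> (act (- x) v)" by (simp add: hom_add_uminus[OF \<psi>])
    have "cocycle (\<psi> x) (\<sigma> (act (- x) v)) = h (act (- x) v) + \<theta> (cocycle x (act (- x) v)) - h v"
      by (simp add: PD[OF that])
    then show "cocycle (\<psi> (- x)) (\<sigma> v) = h v + \<theta> (cocycle (- x) v) - h (act (- x) v)"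
      by (simp add: hom_add_uminus[OF \<psi>] hom_add_uminus[OF \<theta>] cocycle_uminus 1 minus_add
          diff_conv_add_uminus add.assoc del: add_uminus_conv_diff)
  qed
  have gen: "P (gen s)" for s unfolding P_def using act coc by blast
  have "P x"
  proof (induction x rule: fgroup_induct)
    case zero
    show ?case by (simp add: P_def hom_add_0[OF \<psi>] hom_add_0[OF \<theta>])
  next
    case (add l x)
    have "P (of_word [l])" using gen uminus by (simp add: of_word_single)
    then show ?case using add.IH by (rule P_add)
  qed
  then show ?thesis unfolding P_def by blast
qed


section \<open>Invariance\<close>

text \<open>Modulo inner automorphisms and signed permutations of the generators, the three functions
  are the cyclic permutations of the three peripheral classes of \<open>Q\<close>.\<close>

definition turn :: "nat \<Rightarrow> bool fgroup \<Rightarrow> bool fgroup" where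
  "turn j = (if j = 0 then \<lambda>x. x
     else if j = 1 then hom2 (gen False) (gen True - gen False)
     else hom2 (gen True - gen False) (gen False))"

definition turn_sum :: "(nat \<Rightarrow> nat \<Rightarrow> real) \<Rightarrow> bool fgroup \<Rightarrow> real" where
  "turn_sum l x = run_count l (turn 0 x) + run_count l (turn 1 x) + run_count l (turn 2 x)"

definition total_count :: "(nat \<Rightarrow> nat \<Rightarrow> real) \<Rightarrow> bool fgroup \<Rightarrow> real" where
  "total_count l x = (\<Sum>v\<in>UNIV. turn_sum l (cocycle x v))"

lemma hom_turn: "hom_add (turn j)"
  by (auto simp: turn_def hom_lift) (simp add: hom_add_def)

lemma hom2_gen [simp]: "hom2 (gen True) (gen False) x = x"
  by (rule hom2_eqI) (simp_all add: hom_lift, simp add: hom_add_def)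

locale antisymmetric_weight =
  fixes l :: "nat \<Rightarrow> nat \<Rightarrow> real"
  assumes bound: "\<forall>x y. \<bar>l x y\<bar> \<le> 1" and antisym: "\<And>x y. l y x = - l x y"
begin

lemma qm_count: "qm (run_count l :: 'a fgroup \<Rightarrow> real)"
  by (rule qm_run_count) (use bound antisym in blast)+

lemma qm_turn_sum: "qm (turn_sum l)"
  unfolding turn_sum_def
  by (intro qm_add qm_hom[OF qm_count hom_turn])

text \<open>As \<open>act x\<close> permutes the cosets, the sum for \<open>y\<close> can be
  reindexed to match the cocycle rule. The defect is then a sum of four defects of
  \<open>turn_sum\<close>.\<close>

lemma qm_total: "qm (total_count l)"
proof -
  obtain D where D: "\<And>x y. \<bar>turn_sum l (x + y) - turn_sum l x - turn_sum l y\<bar> \<le> D"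
    using qm_turn_sum by (auto simp: qm_def)
  show ?thesis
  proof (rule qmI)
    fix x y
    have "total_count l y = (\<Sum>v\<in>UNIV. turn_sum l (cocycle y (act x v)))"
      unfolding total_count_def using sum.reindex_bij_betw[OF bij_act[of x], of "\<lambda>v. turn_sum l (cocycle y v)"]
      by simp
    then have "total_count l (x + y) - total_count l x - total_count l y
      = (\<Sum>v\<in>UNIV. turn_sum l (cocycle x v + cocycle y (act x v))
          - turn_sum l (cocycle x v) - turn_sum l (cocycle y (act x v)))"
      by (simp add: total_count_def cocycle_add sum_subtractf)
    also have "\<bar>\<dots>\<bar> \<le> (\<Sum>v\<in>(UNIV :: (bool \<times> bool) set). D)"
      by (rule order_trans[OF sum_abs]) (intro sum_mono D)
    finally show "\<bar>total_count l (x + y) - total_count l x - total_count l y\<bar> \<le> (\<Sum>v\<in>(UNIV :: (bool \<times> bool) set). D)" .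
  qed
qed

text \<open>Reindexing the sum absorbs \<open>\<sigma>\<close>. The coboundary terms take finitely
  many values, so they change the sum only boundedly, and \<open>\<theta>\<close> is handled by the
  last hypothesis.\<close>

lemma close_total:
  assumes \<psi>: "hom_add \<psi>" and \<theta>: "hom_add \<theta>" and \<sigma>: "bij \<sigma>"
    and act: "\<And>s v. act (\<psi> (gen s)) (\<sigma> v) = \<sigma> (act (gen s) v)"
    and coc: "\<And>s v. cocycle (\<psi> (gen s)) (\<sigma> v) = h v + \<theta> (cocycle (gen s) v) - h (act (gen s) v)"
    and close: "close (\<lambda>x. turn_sum l (\<theta> x)) (turn_sum l)"
  shows "close (\<lambda>x. total_count l (\<psi> x)) (total_count l)"
proof -
  have "total_count l (\<psi> x) = (\<Sum>v\<in>UNIV. turn_sum l (h v + \<theta> (cocycle x v) + - h (act x v)))" for x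
  proof -
    have "total_count l (\<psi> x) = (\<Sum>v\<in>UNIV. turn_sum l (cocycle (\<psi> x) (\<sigma> v)))"
      unfolding total_count_def by (rule sum.reindex_bij_betw[OF \<sigma>, symmetric])
    then show ?thesis using intertwine[OF \<psi> \<theta> act coc, of x] by simp
  qed
  then have eq: "(\<lambda>x. total_count l (\<psi> x))
      = (\<lambda>x. \<Sum>v\<in>UNIV. turn_sum l (h v + \<theta> (cocycle x v) + - h (act x v)))"
    by (rule ext)
  have 1: "close (\<lambda>x. \<Sum>v\<in>UNIV. turn_sum l (h v + \<theta> (cocycle x v) + - h (act x v)))
      (\<lambda>x. \<Sum>v\<in>UNIV. turn_sum l (\<theta> (cocycle x v)))"
  proof (rule close_sum)
    fix v
    have "range (\<lambda>x. - h (act x v)) \<subseteq> range (\<lambda>v. - h v)" by auto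
    then have "finite (range (\<lambda>x. - h (act x v)))" by (rule finite_subset) simp
    then show "close (\<lambda>x. turn_sum l (h v + \<theta> (cocycle x v) + - h (act x v)))
        (\<lambda>x. turn_sum l (\<theta> (cocycle x v)))"
      using close_translate[OF qm_turn_sum, of "\<lambda>_. h v" "\<lambda>x. - h (act x v)"
          "\<lambda>x. \<theta> (cocycle x v)"] by simp
  qed simp
  have 2: "close (\<lambda>x. \<Sum>v\<in>UNIV. turn_sum l (\<theta> (cocycle x v))) (total_count l)"
    unfolding total_count_def[abs_def] by (rule close_sum[OF _ close_comp[OF close]]) simp
  show ?thesis unfolding eq by (rule close_trans[OF 1 2])
qed

lemma close_run_count:
  assumes "\<And>x. f x = r + hom2 (of_word [a]) (of_word [b]) (g x) - r" "fst a \<noteq> fst b"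
  shows "close (\<lambda>x. run_count l (f x)) (\<lambda>x. run_count l (g x))"
  using close_conj[OF qm_count, of r "\<lambda>x. hom2 (of_word [a]) (of_word [b]) (g x)"] assms
  by (simp add: run_count_signed)

text \<open>Composition with \<open>\<theta>\<close> turns the \<open>i\<close>-th count into the
  \<open>j\<close>-th if the maps agree on generators up to the signed permutation given by
  \<open>a\<close>, \<open>b\<close> and conjugation by \<open>r\<close>, because these change the
  count only boundedly.\<close>

lemma close_turn:
  assumes "hom_add \<theta>" "fst a \<noteq> fst b"
    and "\<And>s. turn i (\<theta> (gen s)) = r + hom2 (of_word [a]) (of_word [b]) (turn j (gen s)) - r"
  shows "close (\<lambda>x. run_count l (turn i (\<theta> x))) (\<lambda>x. run_count l (turn j x))"
proof (rule close_run_count[OF _ assms(2)])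
  fix x
  have 1: "hom_add (\<lambda>x. turn i (\<theta> x))" by (rule hom_add_comp[OF hom_turn assms(1)])
  have 2: "hom_add (\<lambda>x. r + hom2 (of_word [a]) (of_word [b]) (turn j x) - r)"
    by (rule hom_add_comp[OF hom_conj hom_add_comp[OF hom_lift hom_turn]])
  show "turn i (\<theta> x) = r + hom2 (of_word [a]) (of_word [b]) (turn j x) - r"
    by (rule hom_eqI[OF 1 2 assms(3)])
qed

section \<open>Effect of the Nielsen moves\<close>

lemmas turn_simps = turn_def of_word_single pair_def lift_uminus lift_add lift_diff
  diff_conv_add_uminus add.assoc minus_add

text \<open>Up to bounded error this map keeps the count for \<open>turn 0\<close> and exchanges
  those for \<open>turn 1\<close> and \<open>turn 2\<close>.\<close>

lemma close_turn_sum_swap: "close (\<lambda>x. turn_sum l (hom2 (- gen False) (- gen True) x)) (turn_sum l)"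
proof -
  let ?\<theta> = "hom2 (- gen False) (- gen True)"
  have 0: "close (\<lambda>x. run_count l (turn 0 (?\<theta> x))) (\<lambda>x. run_count l (turn 0 x))"
    by (rule close_turn[of _ "(False, False)" "(True, False)" _ 0])
      (auto simp: hom_lift turn_simps simp del: add_uminus_conv_diff)
  have 1: "close (\<lambda>x. run_count l (turn 1 (?\<theta> x))) (\<lambda>x. run_count l (turn 2 x))"
    by (rule close_turn[of _ "(True, False)" "(False, False)" _ "gen False"])
      (auto simp: hom_lift turn_simps simp del: add_uminus_conv_diff)
  have 2: "close (\<lambda>x. run_count l (turn 2 (?\<theta> x))) (\<lambda>x. run_count l (turn 1 x))"
    by (rule close_turn[of _ "(True, False)" "(False, False)" _ "gen False"])
      (auto simp: hom_lift turn_simps simp del: add_uminus_conv_diff)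
  show ?thesis
    using close_add[OF close_add[OF 0 2] 1] unfolding turn_sum_def
    by (simp add: add.commute add.left_commute)
qed

lemma close_turn_sum_neg: "close (\<lambda>x. turn_sum l (hom2 (- gen True) (- gen False) x)) (turn_sum l)"
proof -
  let ?\<theta> = "hom2 (- gen True) (- gen False)"
  have "close (\<lambda>x. run_count l (turn j (?\<theta> x))) (\<lambda>x. run_count l (turn j x))" for j
    by (rule close_turn[of _ "(True, False)" "(False, False)" _ "if j = 0 then 0 else gen False"])
      (auto simp: hom_lift turn_simps simp del: add_uminus_conv_diff)
  then show ?thesis unfolding turn_sum_def by (intro close_add)
qed

text \<open>The map that the move \<open>x + y\<close> induces on the outputs. It exchanges the
  counts for \<open>turn 0\<close> and \<open>turn 2\<close> and keeps the one for
  \<open>turn 1\<close>.\<close>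

lemma close_turn_sum_add: "close (\<lambda>x. turn_sum l (hom2 (- gen True - gen False) (gen False) x)) (turn_sum l)"
proof -
  let ?\<theta> = "hom2 (- gen True - gen False) (gen False)"
  have 0: "close (\<lambda>x. run_count l (turn 0 (?\<theta> x))) (\<lambda>x. run_count l (turn 2 x))"
    by (rule close_turn[of _ "(True, False)" "(False, True)" _ 0])
      (auto simp: hom_lift turn_simps simp del: add_uminus_conv_diff)
  have 1: "close (\<lambda>x. run_count l (turn 1 (?\<theta> x))) (\<lambda>x. run_count l (turn 1 x))"
    by (rule close_turn[of _ "(False, False)" "(True, False)" _ "gen True"])
      (auto simp: hom_lift turn_simps simp del: add_uminus_conv_diff)
  have 2: "close (\<lambda>x. run_count l (turn 2 (?\<theta> x))) (\<lambda>x. run_count l (turn 0 x))"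
    by (rule close_turn[of _ "(True, False)" "(False, True)" _ "gen False"])
      (auto simp: hom_lift turn_simps simp del: add_uminus_conv_diff)
  show ?thesis
    using close_add[OF close_add[OF 2 1] 0] unfolding turn_sum_def
    by (simp add: add.commute add.left_commute)
qed

lemma bool_pair_bijI: "(\<And>v. f (f v) = v) \<Longrightarrow> bij f"
  by (rule bij_betwI[of _ _ _ f]) simp_all

lemma close_total_swap: "close (\<lambda>x. total_count l (hom2 (gen False) (gen True) x)) (total_count l)"
proof (rule close_total[OF hom_lift hom_lift _ _ _ close_turn_sum_swap])
  \<comment> \<open>The exchange of the components followed by a translation of the cosets; with
    this choice the coboundary term is zero.\<close>
  let ?\<sigma> = "\<lambda>v. (\<not> snd v, \<not> fst v)"
  show "bij ?\<sigma>" by (rule bool_pair_bijI) simp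
  show "act (hom2 (gen False) (gen True) (gen s)) (?\<sigma> v) = ?\<sigma> (act (gen s) v)" for s v
    by (cases s) auto
  show "cocycle (hom2 (gen False) (gen True) (gen s)) (?\<sigma> v)
      = 0 + hom2 (- gen False) (- gen True) (cocycle (gen s) v) - 0" for s v
    by (cases s) (auto simp: emit_def lift_uminus)
qed

lemma close_total_neg: "close (\<lambda>x. total_count l (hom2 (- gen True) (gen False) x)) (total_count l)"
proof (rule close_total[OF hom_lift hom_lift _ _ _ close_turn_sum_neg])
  \<comment> \<open>Negation is trivial modulo 2, so only a translation is left, again chosen to
    give coboundary zero.\<close>
  let ?\<sigma> = "\<lambda>v. (\<not> fst v, snd v)"
  show "bij ?\<sigma>" by (rule bool_pair_bijI) simp
  show "act (hom2 (- gen True) (gen False) (gen s)) (?\<sigma> v) = ?\<sigma> (act (gen s) v)" for s v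
    by (cases s) auto
  show "cocycle (hom2 (- gen True) (gen False) (gen s)) (?\<sigma> v)
      = 0 + hom2 (- gen True) (- gen False) (cocycle (gen s) v) - 0" for s v
    by (cases s) (auto simp: emit_def lift_uminus cocycle_uminus)
qed

lemma close_total_add:
  "close (\<lambda>x. total_count l (hom2 (gen True + gen False) (gen False) x)) (total_count l)"
proof (rule close_total[OF hom_lift hom_lift _ _ _ close_turn_sum_add])
  let ?\<sigma> = "\<lambda>v :: bool \<times> bool. (fst v, fst v \<noteq> snd v)"
  \<comment> \<open>The outputs now match only after a correction, needed at a single coset.\<close>
  let ?h = "\<lambda>v. if v = (True, False) then - gen False else 0"
  show "bij ?\<sigma>" by (rule bool_pair_bijI) auto
  show "act (hom2 (gen True + gen False) (gen False) (gen s)) (?\<sigma> v) = ?\<sigma> (act (gen s) v)" for s v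
    by (cases s) (auto simp: act_add)
  show "cocycle (hom2 (gen True + gen False) (gen False) (gen s)) (?\<sigma> v)
      = ?h v + hom2 (- gen True - gen False) (gen False) (cocycle (gen s) v) - ?h (act (gen s) v)" for s v
    by (cases s; cases v)
      (auto simp: emit_def lift_uminus cocycle_add minus_add
        diff_conv_add_uminus add.assoc simp del: add_uminus_conv_diff)
qed

text \<open>Applying a move to \<open>(u, v)\<close> amounts to precomposing \<open>hom2 u v\<close>
  with the same move on the generators, so invariance propagates along the moves. Conjugation is
  covered by conjugation invariance of homogenisations.\<close>

lemma homog_total_nielsen:
  assumes "nielsen (gen True) (gen False) u v"
  shows "homog (total_count l) (hom2 u v x) = homog (total_count l) x"
proof -
  let ?f = "homog (total_count l)"
  have move: "?f (hom2 p q x) = ?f x" if "close (\<lambda>x. total_count l (hom2 p q x)) (total_count l)" for p q x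
    by (rule homog_invariant[OF qm_total hom_lift that])
  have comp: "?f (hom2 u' v' x) = ?f x"
    if "\<And>x. ?f (hom2 u v x) = ?f x" "close (\<lambda>x. total_count l (hom2 p q x)) (total_count l)"
      "hom2 u v p = u'" "hom2 u v q = v'" for u v p q u' v' x
    using that(1)[of "hom2 p q x"] move[OF that(2)] by (simp add: hom2_hom[OF hom_lift] that(3,4))
  show ?thesis using assms
  proof (induction arbitrary: x rule: nielsen.induct)
    case (swap u v)
    show ?case by (rule comp[OF swap.IH close_total_swap]) simp_all
  next
    case (neg u v)
    show ?case by (rule comp[OF neg.IH close_total_neg]) (simp_all add: lift_uminus)
  next
    case (add u v)
    show ?case by (rule comp[OF add.IH close_total_add]) (simp_all add: lift_add)
  next
    case (conj u v r)
    have "hom2 (r + u - r) (r + v - r) x = r + hom2 u v x - r"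
      by (rule hom2_hom[OF hom_conj, symmetric])
    then show ?case by (simp only: homog_conj[OF qm_total] conj.IH)
  qed simp
qed

text \<open>The images of the generators form a generating pair, so Nielsen's theorem, read
  backwards, reaches them from the generators.\<close>

theorem homog_total_automorphism:
  assumes "hom_add \<psi>" "surj \<psi>"
  shows "homog (total_count l) (\<psi> x) = homog (total_count l) x"
proof -
  let ?u = "\<psi> (gen True)" and ?v = "\<psi> (gen False)"
  have \<psi>: "\<psi> x = hom2 ?u ?v x" for x
    using hom2_hom[OF assms(1), of "gen True" "gen False" x] by simp
  then have "\<psi> = hom2 ?u ?v" by (rule ext)
  with assms(2) have "generates ?u ?v" by (simp add: generates_def)
  from homog_total_nielsen[OF nielsen_sym[OF nielsen_generates[OF this]]]
  show ?thesis unfolding \<psi>[of x] .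
qed

end

section \<open>Evaluation on test elements\<close>

definition weight :: "nat \<Rightarrow> nat \<Rightarrow> nat \<Rightarrow> real" where
  "weight n x y = (if x = 2 \<and> y = n then 1 else 0) - (if x = n \<and> y = 2 then 1 else 0)"

interpretation weight: antisymmetric_weight "weight n"
  by unfold_locales (auto simp: weight_def)

lemma nmul_letter: "nmul n (of_word [l]) = of_word (replicate n l)"
proof (induction n)
  case (Suc n)
  then show ?case using of_word_Cons[of l "replicate n l"] by simp
qed simp

lemma of_word_concat: "of_word (concat ws) = sum_list (map of_word ws)"
  by (induction ws) (simp_all add: of_word_append)

lemma nmul_of_word: "nmul k (of_word w) = of_word (concat (replicate k w))"
  by (simp add: nmul_def of_word_concat)

lemma expand_concat: "expand (concat bss) = concat (map expand bss)"
  by (induction bss) simp_all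

lemma nmul_expand: "nmul k (of_word (expand bs)) = of_word (expand (concat (replicate k bs)))"
  by (simp add: nmul_of_word expand_concat)

text \<open>The value of the cocycle at a word in \<open>a\<^sup>2\<close> and \<open>b\<^sup>2\<close> is that word in \<open>a\<^sup>\<plusminus>\<^sup>1\<close> and \<open>b\<^sup>\<plusminus>\<^sup>1\<close>. The cyclic
  sequence of exponents 2, \<open>m\<close>, 3, 3 contains 2 followed by \<open>m\<close> but not \<open>m\<close> followed by 2.\<close>

definition test_word :: "nat \<Rightarrow> 'g::monoid_add \<Rightarrow> 'g \<Rightarrow> 'g" where
  "test_word m u v = nmul 2 u + nmul m v + nmul 3 u + nmul 3 v"

lemma test_word_hom: "hom_add h \<Longrightarrow> h (test_word m u v) = test_word m (h u) (h v)"
  for h :: "'a::group_add \<Rightarrow> 'b::group_add"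
  by (simp only: test_word_def hom_addD nmul_hom)

definition test :: "nat \<Rightarrow> bool fgroup" where
  "test m = test_word m (nmul 2 (gen True)) (nmul 2 (gen False))"

text \<open>As \<open>n \<ge> 4\<close>, pairs involving the exponent 3 have weight zero, including
  the pair 3, 2 at the seam between periods. Each period contributes through the pair 2,
  \<open>m\<close> alone.\<close>

lemma count_test_word:
  assumes "n \<ge> 4" "m \<ge> 4" "fst a \<noteq> fst b"
  shows "run_count (weight n) (nmul k (test_word m (of_word [a]) (of_word [b]))) = (if n = m then real k else 0)"
proof -
  let ?bs = "[(a, 2), (b, m), (a, 3), (b, 3)]"
  have w: "test_word m (of_word [a]) (of_word [b]) = of_word (expand ?bs)"
    by (simp add: test_word_def nmul_letter of_word_append add.assoc)
  have "successively (\<lambda>b c. fst (fst b) \<noteq> fst (fst c)) (concat (replicate k ?bs))"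
    using assms(3) by (induction k) (auto simp: successively_Cons hd_concat hd_replicate split: if_splits)
  moreover have "\<forall>b\<in>set (concat (replicate k ?bs)). 0 < snd b"
    using assms(2) by auto
  ultimately have "run_count (weight n) (nmul k (test_word m (of_word [a]) (of_word [b])))
      = pair_sum (weight n) (map snd (concat (replicate k ?bs)))"
    unfolding w nmul_expand by (rule run_count_expand)
  also have "\<dots> = (if n = m then real k else 0)"
  proof (induction k)
    case (Suc k)
    have 0: "pair_sum (weight n) (3 # map snd (concat (replicate k ?bs)))
        = pair_sum (weight n) (map snd (concat (replicate k ?bs)))"
      using assms(1) by (cases k) (simp_all add: weight_def)
    have "pair_sum (weight n) (map snd (concat (replicate (Suc k) ?bs)))
        = weight n 2 m + weight n m 3 + weight n 3 3
          + pair_sum (weight n) (3 # map snd (concat (replicate k ?bs)))"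
      by simp
    also have "\<dots> = (if n = m then real (Suc k) else 0)"
      unfolding 0 Suc.IH using assms(1,2) by (auto simp: weight_def)
    finally show ?case .
  qed simp
  finally show ?thesis .
qed

text \<open>In a product of blocks \<open>a\<^sup>\<plusminus>\<^sup>1 b\<^sup>n\<close>, \<open>n \<noteq> 0\<close>, every second run has length 1. Up to conjugation, the
  images of test words under \<open>turn 1\<close> and \<open>turn 2\<close> are of this form.\<close>

definition B_pow :: "bool \<Rightarrow> bool fgroup" where
  "B_pow d = of_word [(False, d)]"

definition block :: "bool \<times> bool \<times> nat \<Rightarrow> bool fgroup" where
  "block = (\<lambda>(e, d, n). of_word (expand [((True, e), 1), ((False, d), n)]))"

lemma count_blocks:
  assumes "n \<ge> 4" "\<forall>(e, d, k)\<in>set bs. 0 < k"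
  shows "run_count (weight n) (sum_list (map block bs)) = 0"
proof -
  let ?f = "\<lambda>(e, d, n). [((True, e), 1), ((False, d), n :: nat)]"
  let ?bs = "concat (map ?f bs)"
  have s: "sum_list (map block bs) = of_word (expand ?bs)"
    by (induction bs) (auto simp: block_def case_prod_unfold simp flip: of_word_append)
  have hd: "?bs = [] \<or> fst (fst (hd ?bs)) = True" "?bs = [] \<or> snd (hd ?bs) = 1"
    by (cases bs; auto)+
  have "successively (\<lambda>b c. fst (fst b) \<noteq> fst (fst c)) ?bs"
  proof (induction bs)
    case (Cons b bs)
    then show ?case by (cases b; cases bs) (auto simp: successively_Cons)
  qed simp
  moreover have "\<forall>b\<in>set ?bs. 0 < snd b" using assms(2) by auto
  ultimately have "run_count (weight n) (sum_list (map block bs)) = pair_sum (weight n) (map snd ?bs)"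
    unfolding s by (rule run_count_expand)
  also have "\<dots> = 0"
  proof (induction bs)
    case (Cons b bs)
    then show ?case using assms(1) by (cases b; cases bs) (auto simp: weight_def)
  qed simp
  finally show ?thesis .
qed

text \<open>A conjugate of \<open>D_elt e\<close> below, written so that it begins with a power of
  the first generator.\<close>

definition E_block :: "bool \<Rightarrow> bool fgroup" where
  "E_block e = block (e, \<not> e, 1)"

text \<open>The last letter of \<open>E_block e\<close> merges with the power or cancels one of its
  letters. The new exponent is \<open>r + 1\<close> or \<open>r - 1\<close>, still positive since
  \<open>r \<ge> 2\<close>.\<close>

lemma E_block_B_pow:
  assumes "r \<ge> 2"
  obtains d' r' where "r' > 0" "E_block e + nmul r (B_pow d) = block (e, d', r')"
proof (cases "d = e")
  case False
  then have "d = (\<not> e)" by auto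
  then have "E_block e + nmul r (B_pow d) = block (e, d, Suc r)"
    by (simp add: E_block_def block_def B_pow_def nmul_letter of_word_append[symmetric])
  then show thesis by (intro that[of "Suc r"]) auto
next
  case True
  obtain r' where r': "r = Suc r'" "r' > 0" using assms by (cases r) auto
  have inv: "(False, \<not> e) = inv_letter (False, e)" by (simp add: inv_letter_def)
  have "E_block e = of_word [(True, e)] - of_word [(False, e)]"
    using of_word_Cons[of "(True, e)" "[(False, \<not> e)]"]
    by (simp add: E_block_def block_def inv of_word_inv_letter del: inv_letter_simps)
  then have "E_block e + nmul r (B_pow d) = of_word [(True, e)] + nmul r' (of_word [(False, e)])"
    by (simp add: True r' B_pow_def diff_conv_add_uminus add.assoc del: add_uminus_conv_diff)
  also have "\<dots> = block (e, e, r')"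
    using of_word_Cons[of "(True, e)" "replicate r' (False, e)"] by (simp add: block_def nmul_letter)
  finally show thesis using r' by (intro that) auto
qed

text \<open>The last \<open>E_block\<close> before each power of the second generator is merged with
  it; all other factors are blocks already, so the whole power is a product of blocks.\<close>

lemma count_E_block:
  assumes n: "n \<ge> 4" and p: "p \<ge> 2" and r: "r \<ge> 2" and q: "q \<ge> 1" and s: "s \<ge> 1"
  shows "run_count (weight n) (nmul k (nmul q (E_block e) + nmul r (B_pow d)
      + nmul s (E_block e) + nmul p (B_pow d))) = 0"
proof -
  obtain d1 r1 where 1: "r1 > 0" "E_block e + nmul r (B_pow d) = block (e, d1, r1)"
    using E_block_B_pow[OF r] by metis
  obtain d2 r2 where 2: "r2 > 0" "E_block e + nmul p (B_pow d) = block (e, d2, r2)"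
    using E_block_B_pow[OF p] by metis
  obtain q' s' where qs: "q = Suc q'" "s = Suc s'" using q s by (cases q; cases s) auto
  let ?bs = "replicate q' (e, \<not> e, 1) @ [(e, d1, r1)] @ replicate s' (e, \<not> e, 1) @ [(e, d2, r2)]"
  have "nmul q (E_block e) + nmul r (B_pow d) + nmul s (E_block e) + nmul p (B_pow d)
      = nmul q' (E_block e) + (E_block e + nmul r (B_pow d))
        + nmul s' (E_block e) + (E_block e + nmul p (B_pow d))"
    unfolding qs nmul_Suc2 by (simp only: add.assoc)
  also have "\<dots> = sum_list (map block ?bs)"
    unfolding 1 2 by (simp add: nmul_def E_block_def add.assoc)
  finally have "nmul k (nmul q (E_block e) + nmul r (B_pow d) + nmul s (E_block e) + nmul p (B_pow d))
      = sum_list (map block (concat (replicate k ?bs)))"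
    by (induction k) (simp_all add: add.assoc)
  also have "run_count (weight n) \<dots> = 0"
    using 1(1) 2(1) by (intro count_blocks[OF n]) auto
  finally show ?thesis .
qed

section \<open>Vanishing of the two turned counts on test words\<close>

abbreviation vanishing :: "nat \<Rightarrow> bool fgroup \<Rightarrow> bool" where
  "vanishing n x \<equiv> close (\<lambda>k. run_count (weight n) (nmul k x)) (\<lambda>k. 0)"

lemma vanishing_conj: "vanishing n x \<Longrightarrow> vanishing n (g + x - g)"
proof -
  assume x: "vanishing n x"
  have "close (\<lambda>k. run_count (weight n) (g + nmul k x - g)) (\<lambda>k. run_count (weight n) (nmul k x))"
    by (rule close_conj[OF weight.qm_count])
  from close_trans[OF this x] show ?thesis by (simp add: nmul_hom[OF hom_conj, of g])
qed

definition D_elt :: "bool \<Rightarrow> bool fgroup" where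
  "D_elt e = (if e then gen True - gen False else - (gen True - gen False))"

lemma nmul_commute:
  fixes c x :: "'g::monoid_add"
  assumes "c + x = x + c" shows "c + nmul r x = nmul r x + c"
proof (induction r)
  case (Suc r)
  have "c + nmul (Suc r) x = x + (c + nmul r x)"
    by (simp add: assms flip: add.assoc)
  then show ?case by (simp add: Suc.IH add.assoc)
qed simp

lemma B_pow_commute: "gen False + nmul r (B_pow d) = nmul r (B_pow d) + gen False"
  by (rule nmul_commute) (simp add: B_pow_def of_word_single)

lemma vanishing_main:
  assumes "n \<ge> 4" "p \<ge> 2" "r \<ge> 2" "q \<ge> 1" "s \<ge> 1"
  shows "vanishing n (nmul p (B_pow d) + nmul q (D_elt e) + nmul r (B_pow d) + nmul s (D_elt e))"
proof -
  let ?x = "nmul q (E_block e) + nmul r (B_pow d) + nmul s (E_block e) + nmul p (B_pow d)"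
  let ?y = "nmul p (B_pow d) + nmul q (E_block e) + nmul r (B_pow d) + nmul s (E_block e)"
  have x: "vanishing n ?x"
    using count_E_block[OF assms] by (simp add: close_refl)
  have "nmul p (B_pow d) + ?x - nmul p (B_pow d) = ?y"
    by (simp add: add.assoc diff_conv_add_uminus del: add_uminus_conv_diff)
  then have y: "vanishing n ?y" using vanishing_conj[OF x, of "nmul p (B_pow d)"] by simp
  \<comment> \<open>Conjugation by \<open>c\<close> carries \<open>E_block e\<close> to
    \<open>D_elt e\<close>. Being trivial or the second generator, \<open>c\<close> commutes with
    all powers of \<open>B_pow d\<close> and thus conjugates the whole product.\<close>
  define c :: "bool fgroup" where "c = (if e then 0 else gen False)"
  have D: "D_elt e = c + E_block e - c"
    using of_word_Cons[of "(True, e)" "[(False, \<not> e)]"]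
    by (simp add: D_elt_def E_block_def block_def c_def of_word_single
        diff_conv_add_uminus add.assoc minus_add del: add_uminus_conv_diff)
  have c: "nmul t (B_pow d) + (c + z) = c + (nmul t (B_pow d) + z)" for t z
    using B_pow_commute[of t d] by (auto simp: c_def simp flip: add.assoc)
  have "nmul p (B_pow d) + nmul q (D_elt e) + nmul r (B_pow d) + nmul s (D_elt e) = c + ?y - c"
    unfolding D nmul_hom[OF hom_conj, of c, symmetric]
    by (simp add: c add.assoc diff_conv_add_uminus del: add_uminus_conv_diff)
  then show ?thesis using vanishing_conj[OF y, of c] by simp
qed

lemma turn_letters:
  "turn 1 (of_word [(True, e)]) = B_pow e" "turn 1 (of_word [(False, d)]) = D_elt d"
  "turn 2 (of_word [(True, e)]) = D_elt e" "turn 2 (of_word [(False, d)]) = B_pow d"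
  by (auto simp: turn_def of_word_single B_pow_def D_elt_def lift_uminus)

lemma close_turn_sum_test_word:
  assumes "n \<ge> 4" "m \<ge> 4"
  shows "close (\<lambda>k. turn_sum (weight n) (nmul k (test_word m (of_word [(True, e)]) (of_word [(False, d)]))))
    (\<lambda>k. if n = m then real k else 0)"
proof -
  let ?w = "test_word m (of_word [(True, e)]) (of_word [(False, d)])"
  have 0: "run_count (weight n) (nmul k (turn 0 ?w)) = (if n = m then real k else 0)" for k
    using count_test_word[OF assms, of "(True, e)" "(False, d)" k] by (simp add: turn_def)
  have "turn 1 ?w = nmul 2 (B_pow e) + nmul m (D_elt d) + nmul 3 (B_pow e) + nmul 3 (D_elt d)"
    by (simp only: test_word_hom[OF hom_turn] turn_letters) (simp only: test_word_def)
  then have 1: "vanishing n (turn 1 ?w)"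
    using vanishing_main[of n 2 3 m 3 e d] assms by simp
  have v: "vanishing n (nmul 3 (B_pow d) + nmul 2 (D_elt e) + nmul m (B_pow d) + nmul 3 (D_elt e))"
    using vanishing_main[of n 3 m 2 3 d e] assms by simp
  \<comment> \<open>Under \<open>turn 2\<close> the two kinds of factors change places; a cyclic
    rotation brings the product into the form of \<open>vanishing_main\<close>.\<close>
  have "turn 2 ?w = - nmul 3 (B_pow d)
      + (nmul 3 (B_pow d) + nmul 2 (D_elt e) + nmul m (B_pow d) + nmul 3 (D_elt e)) - - nmul 3 (B_pow d)"
    by (simp only: test_word_hom[OF hom_turn] turn_letters)
      (simp only: test_word_def diff_minus_eq_add add.assoc minus_add_cancel)
  then have 2: "vanishing n (turn 2 ?w)"
    using vanishing_conj[OF v, of "- nmul 3 (B_pow d)"] by simp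
  have "close (\<lambda>k. run_count (weight n) (nmul k (turn 0 ?w)) + run_count (weight n) (nmul k (turn 1 ?w))
      + run_count (weight n) (nmul k (turn 2 ?w))) (\<lambda>k. (if n = m then real k else 0) + 0 + 0)"
    unfolding 0 by (intro close_add close_refl 1 2)
  then show ?thesis by (simp add: turn_sum_def nmul_hom[OF hom_turn])
qed

section \<open>The cocycle on test elements\<close>

lemma act_nmul: "act x v = v \<Longrightarrow> act (nmul k x) v = v"
  by (induction k) (simp_all add: act_add)

lemma cocycle_nmul: "act x v = v \<Longrightarrow> cocycle (nmul k x) v = nmul k (cocycle x v)"
  by (induction k) (simp_all add: cocycle_add)

lemma numeral_nmul: "nmul 2 x = x + x"
  by (simp add: numeral_2_eq_2)

lemma act_double_gen: "act (nmul 2 (gen s)) v = v"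
  by (simp add: numeral_nmul act_add)

lemma cocycle_double_gen:
  "cocycle (nmul 2 (gen True)) v = of_word [(True, snd v)]"
  "cocycle (nmul 2 (gen False)) v = of_word [(False, fst v)]"
  by (auto simp: numeral_nmul cocycle_add emit_def of_word_single)

lemma act_test: "act (test m) v = v"
  by (simp only: test_def test_word_def act_add act_nmul[OF act_double_gen])

lemma cocycle_test:
  "cocycle (test m) v = test_word m (of_word [(True, snd v)]) (of_word [(False, fst v)])"
  by (simp only: test_def test_word_def cocycle_add act_add act_nmul[OF act_double_gen]
      cocycle_nmul[OF act_double_gen] cocycle_double_gen)

text \<open>At each of the four cosets the cocycle gives the same test word up to signs of the
  letters. Each coset contributes 1 per period if \<open>n = m\<close> and nothing
  otherwise.\<close>

lemma homog_total_test:
  assumes "n \<ge> 4" "m \<ge> 4"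
  shows "homog (total_count (weight n)) (test m) = (if n = m then 4 else 0)"
proof -
  have "close (\<lambda>k. total_count (weight n) (nmul k (test m)))
      (\<lambda>k. \<Sum>v\<in>(UNIV :: (bool \<times> bool) set). if n = m then real k else 0)"
    unfolding total_count_def cocycle_nmul[OF act_test] cocycle_test
    by (intro close_sum close_turn_sum_test_word assms) simp
  then obtain C where C: "\<And>k. \<bar>total_count (weight n) (nmul k (test m))
      - (\<Sum>v\<in>(UNIV :: (bool \<times> bool) set). if n = m then real k else 0)\<bar> \<le> C"
    by (auto simp: close_def)
  have "card (UNIV :: (bool \<times> bool) set) = 4"
    by (simp add: UNIV_Times_UNIV[symmetric] card_cartesian_product del: UNIV_Times_UNIV)
  with C show ?thesis
    by (intro homog_eqI[OF weight.qm_total, of _ _ _ C]) (auto split: if_splits simp: mult.commute)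
qed


section \<open>Transfer to \<open>F2\<close>\<close>

lemma F2_simps [simp]:
  "w \<in> carrier F2 \<longleftrightarrow> reduced w" "u \<otimes>\<^bsub>F2\<^esub> v = reduce (u @ v)" "\<one>\<^bsub>F2\<^esub> = []"
  by (simp_all add: F2_def free_group_def)

interpretation F2: group F2
  unfolding F2_def by (rule group_free_group)

lemma of_word_mult_F2: "of_word (u \<otimes>\<^bsub>F2\<^esub> v) = of_word u + of_word v"
proof -
  have "of_word (reduce (u @ v)) = of_word (u @ v)"
    by (rule of_word_eqI) (simp add: reduce_reduced reduced_reduce)
  then show ?thesis by (simp add: of_word_append)
qed

lemma of_word_nat_pow_F2: "of_word (w [^]\<^bsub>F2\<^esub> (k :: nat)) = nmul k (of_word w)"
proof (induction k)
  case (Suc k)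
  have "of_word (w [^]\<^bsub>F2\<^esub> Suc k) = of_word (w [^]\<^bsub>F2\<^esub> k \<otimes>\<^bsub>F2\<^esub> w)" by simp
  also have "\<dots> = nmul k (of_word w) + of_word w" unfolding of_word_mult_F2 Suc.IH ..
  finally show ?case by (simp only: nmul_Suc2)
qed simp

lemma of_word_inv_F2:
  assumes "reduced w" shows "of_word (inv\<^bsub>F2\<^esub> w) = - of_word w"
proof -
  have "of_word (inv\<^bsub>F2\<^esub> w) + of_word w = of_word (\<one>\<^bsub>F2\<^esub>)"
    using F2.l_inv[of w] assms by (simp only: of_word_mult_F2[symmetric] F2_simps(1))
  then show ?thesis by (simp add: eq_neg_iff_add_eq_0)
qed

text \<open>The shift by 4 makes every index admissible for \<open>homog_total_test\<close>; the
  value zero off the carrier is the convention of \<open>invariant_quasimorphisms\<close>.\<close>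

definition aut_quasi :: "nat \<Rightarrow> bool letter list \<Rightarrow> real" where
  "aut_quasi n w = (if reduced w then homog (total_count (weight (n + 4))) (of_word w) else 0)"

lemma aut_quasi_invariant: "aut_quasi n \<in> invariant_quasimorphisms F2"
proof -
  let ?f = "homog (total_count (weight (n + 4)))"
  have q: "aut_quasi n w = ?f (of_word w)" if "reduced w" for w
    using that by (simp add: aut_quasi_def)
  obtain D where D: "\<And>x y. \<bar>?f (x + y) - ?f x - ?f y\<bar> \<le> D"
    using qm_homog[OF weight.qm_total[of "n + 4"]] unfolding qm_def by blast
  have "quasimorphism F2 (aut_quasi n)"
    unfolding quasimorphism_def
  proof (intro exI ballI)
    fix a b assume ab: "a \<in> carrier F2" "b \<in> carrier F2"
    then have "aut_quasi n (a \<otimes>\<^bsub>F2\<^esub> b) = ?f (of_word a + of_word b)"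
      using q[OF reduced_reduce] of_word_mult_F2[of a b] by simp
    then show "\<bar>aut_quasi n a - aut_quasi n (a \<otimes>\<^bsub>F2\<^esub> b) + aut_quasi n b\<bar> < D + 1"
      using D[of "of_word a" "of_word b"] ab by (simp only: q F2_simps(1))
  qed
  moreover have "homogeneous F2 (aut_quasi n)"
    unfolding homogeneous_def
  proof (intro ballI allI)
    fix w and k :: int assume w: "w \<in> carrier F2"
    have nat: "?f (of_word (w [^]\<^bsub>F2\<^esub> (m :: nat))) = real m * ?f (of_word w)" for m
      by (simp only: of_word_nat_pow_F2 homog_nmul[OF weight.qm_total])
    have "?f (of_word (w [^]\<^bsub>F2\<^esub> k)) = of_int k * ?f (of_word w)"
    proof (cases "k < 0")
      case True
      have "reduced (w [^]\<^bsub>F2\<^esub> nat (- k))"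
        using F2.nat_pow_closed[OF w, of "nat (- k)"] by (simp only: F2_simps(1))
      then have "of_word (w [^]\<^bsub>F2\<^esub> k) = - of_word (w [^]\<^bsub>F2\<^esub> nat (- k))"
        using True by (simp only: int_pow_def2 of_word_inv_F2 if_True)
      then have "?f (of_word (w [^]\<^bsub>F2\<^esub> k)) = - (real (nat (- k)) * ?f (of_word w))"
        by (simp only: homog_uminus[OF weight.qm_total] nat)
      then show ?thesis using True by simp
    next
      case False
      then have "?f (of_word (w [^]\<^bsub>F2\<^esub> k)) = real (nat k) * ?f (of_word w)"
        by (simp only: int_pow_def2 if_False nat)
      then show ?thesis using False by simp
    qed
    moreover have "reduced w" "reduced (w [^]\<^bsub>F2\<^esub> k)"
      using w F2.int_pow_closed[OF w, of k] by (simp_all only: F2_simps(1))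
    ultimately show "aut_quasi n (w [^]\<^bsub>F2\<^esub> k) = of_int k * aut_quasi n w"
      by (simp add: q)
  qed
  moreover have "Aut_invariant F2 (aut_quasi n)"
    unfolding Aut_invariant_def
  proof (intro ballI)
    fix \<psi> w assume \<psi>: "\<psi> \<in> iso F2 F2" and w: "w \<in> carrier F2"
    have hom: "\<psi> \<in> hom F2 F2" and bij: "bij_betw \<psi> (carrier F2) (carrier F2)"
      using \<psi> by (auto simp: iso_def)
    have red: "reduced (\<psi> v)" if "reduced v" for v
      using hom_in_carrier[OF hom, of v] that by simp
    \<comment> \<open>The values of \<open>\<psi>\<close> outside the carrier are arbitrary; only
      those on reduced words enter here.\<close>
    define \<psi>' where "\<psi>' = (\<lambda>x. of_word (\<psi> (word x)))"
    have "hom_add \<psi>'"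
      unfolding hom_add_def
    proof (intro allI)
      fix x y
      have "\<psi> (word x \<otimes>\<^bsub>F2\<^esub> word y) = \<psi> (word x) \<otimes>\<^bsub>F2\<^esub> \<psi> (word y)"
        by (intro hom_mult[OF hom]) simp_all
      moreover have "word (x + y) = word x \<otimes>\<^bsub>F2\<^esub> word y"
        by (simp add: plus_fgroup_def word_of_word)
      ultimately show "\<psi>' (x + y) = \<psi>' x + \<psi>' y"
        unfolding \<psi>'_def of_word_mult_F2[symmetric] by simp
    qed
    moreover have "surj \<psi>'"
    proof (rule surjI)
      fix x
      let ?v = "inv_into (carrier F2) \<psi> (word x)"
      have "word x \<in> \<psi> ` carrier F2" using bij by (simp add: bij_betw_def)
      then have "\<psi> ?v = word x" "reduced ?v"
        using f_inv_into_f[of "word x" \<psi> "carrier F2"] inv_into_into[of "word x" \<psi> "carrier F2"]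
        by simp_all
      then show "\<psi>' (of_word ?v) = x" by (simp add: \<psi>'_def word_of_reduced)
    qed
    ultimately have "?f (\<psi>' (of_word w)) = ?f (of_word w)"
      by (rule weight.homog_total_automorphism)
    then show "aut_quasi n (\<psi> w) = aut_quasi n w"
      using w by (simp add: \<psi>'_def word_of_reduced q red)
  qed
  ultimately show ?thesis
    by (auto simp: invariant_quasimorphisms_def aut_quasi_def)
qed

lemma aut_quasi_test: "aut_quasi n (word (test (m + 4))) = (if n = m then 4 else 0)"
  by (simp add: aut_quasi_def homog_total_test)

text \<open>Evaluation at \<open>test (n + 4)\<close> is a linear functional that vanishes on the
  whole family except for its \<open>n\<close>-th member.\<close>

lemma independent_aut_quasi: "independent (range aut_quasi)"
  unfolding dependent_def
proof
  assume "\<exists>a\<in>range aut_quasi. a \<in> span (range aut_quasi - {a})"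
  then obtain n where n: "aut_quasi n \<in> span (range aut_quasi - {aut_quasi n})" by blast
  let ?w = "word (test (n + 4))"
  have "span (range aut_quasi - {aut_quasi n}) \<subseteq> {f. f ?w = 0}"
  proof (rule span_minimal)
    show "range aut_quasi - {aut_quasi n} \<subseteq> {f. f ?w = 0}" by (auto simp: aut_quasi_test)
    show "subspace {f :: bool letter list \<Rightarrow> real. f ?w = 0}"
      by (auto simp: subspace_def scaleR_fun_def)
  qed
  with n show False by (auto simp: aut_quasi_test)
qed

theorem theorem2:
  shows "infinite_dimensional (invariant_quasimorphisms F2)"
  unfolding infinite_dimensional_def
proof
  assume "\<exists>B. finite B \<and> independent B \<and> span B = invariant_quasimorphisms F2"
  then obtain B where B: "finite B" "span B = invariant_quasimorphisms F2" by blast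
  have "range aut_quasi \<subseteq> span B" using aut_quasi_invariant B(2) by blast
  \<comment> \<open>A finite spanning set bounds the size of any independent set, whereas the family
    is indexed injectively by the naturals.\<close>
  then have "finite (range aut_quasi)"
    using independent_span_bound[OF B(1) independent_aut_quasi] by blast
  moreover have "inj aut_quasi"
  proof (rule injI)
    fix n m assume "aut_quasi n = aut_quasi m"
    then have "aut_quasi n (word (test (n + 4))) = aut_quasi m (word (test (n + 4)))" by simp
    then show "n = m" by (simp add: aut_quasi_test split: if_splits)
  qed
  ultimately show False using finite_imageD[of aut_quasi UNIV] by simp
qed

end
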